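(* Let $(R,\mathfrak m,\Bbbk)$ be an $F$-finite Noetherian local domain of characteristic $p>0$ and dimension $d$, and let $I_\bullet=\{I_q\}_{q=p^e,\,e\in\mathbb N}$ be a BBL weakly inverse $p$-family of ideals of $R$. Then: (1) The limit $\eta=\lim_{e\to\infty}\ell(R/I_q)/q^d$ (where $q=p^e$) exists. (2) There exists a positive constant $C$ such that $\frac{1}{q^d}\ell(R/I_q)-\eta\le C/q$ for all $q=p^e$, $e\in\mathbb N$. (3) If moreover $I_\bullet$ is also a weakly $p$-family, then there exists a constant $C$ such that $\left|\frac{1}{q^d}\ell(R/I_q)-\eta\right|\le C/q$ for all $q=p^e$, $e\in\mathbb N$.
   Context: $R$ is $F$-finite if it is a finitely generated module over itself via the Frobenius endomorphism. $I^{[p]}=(a^p:a\in I)$. A family of ideals $\{I_q\}$ indexed by $q=p^e$, $e\in\mathbb N=\{0,1,2,\dots\}$, in the domain $R$ is a weakly inverse $p$-family if there is $0\ne c\in R$ with $cI_{pq}\subset I_q^{[p]}$ for all $q$; it is a weakly $p$-family if there is $0\neq c\in R$ with $cI_q^{[p]}\subset I_{pq}$ for all $q$. It is BBL (bounded below linearly) if there is $c\in\mathbb N$ with $\mathfrak m^{cq}\subset I_q$ for all $q=p^e$. $\ell$ is length. *)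

theory Defs
  imports "HOL-Algebra.Algebra" "HOL-Library.Extended_Real" "HOL-Computational_Algebra.Primes"
begin

definition has_characteristic :: "('a, 'b) ring_scheme \<Rightarrow> nat \<Rightarrow> bool" where
  "has_characteristic R n \<longleftrightarrow> (\<forall>k::nat. [k] \<cdot>\<^bsub>R\<^esub> \<one>\<^bsub>R\<^esub> = \<zero>\<^bsub>R\<^esub> \<longleftrightarrow> n dvd k)"

definition local_with_maximal :: "('a, 'b) ring_scheme \<Rightarrow> 'a set \<Rightarrow> bool" where
  "local_with_maximal R \<mm> \<longleftrightarrow> cring R \<and> (\<forall>J. maximalideal J R \<longleftrightarrow> J = \<mm>)"

text \<open>The supremum of all \<open>n\<close> for which there is a strict chain \<open>C 0 \<subset> C 1 \<subset> \<dots> \<subset> C n\<close> in \<open>F\<close>.\<close>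

definition chain_height :: "'a set set \<Rightarrow> enat" where
  "chain_height F =
     Sup {enat n | n. \<exists>C :: nat \<Rightarrow> 'a set. (\<forall>i\<le>n. C i \<in> F) \<and> (\<forall>i<n. C i \<subset> C (Suc i))}"

definition krull_dim :: "('a, 'b) ring_scheme \<Rightarrow> enat" where
  "krull_dim R = chain_height {P. primeideal P R}"

definition module_length :: "('a, 'b) ring_scheme \<Rightarrow> ('a, 'c, 'd) module_scheme \<Rightarrow> enat" where
  "module_length R M = chain_height {N. submodule N R M}"

text \<open>The ring \<open>S\<close> as a module along a ring homomorphism \<open>h\<close> into \<open>S\<close>.\<close>

definition module_via ::
    "('c, 'd) ring_scheme \<Rightarrow> ('a \<Rightarrow> 'c) \<Rightarrow> ('a, 'c) module" where
  "module_via S h =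
     \<lparr>carrier = carrier S, monoid.mult = monoid.mult S, one = one S, ring.zero = ring.zero S, add = add S,
      smult = (\<lambda>r x. h r \<otimes>\<^bsub>S\<^esub> x)\<rparr>"

lemma module_via_is_module:
  assumes "cring R" "cring S" "h \<in> ring_hom R S"
  shows "module R (module_via S h)"
proof -
  interpret R: cring R by fact
  interpret S: cring S by fact
  have "abelian_group (module_via S h)"
    by (rule abelian_groupI)
       (auto simp: module_via_def S.a_assoc intro: S.a_comm
             dest: S.l_neg intro!: bexI[of _ "\<ominus>\<^bsub>S\<^esub> _"] S.l_neg)
  then show ?thesis
    using assms(3)
    by (intro moduleI R.is_cring)
       (auto simp: module_via_def ring_hom_closed ring_hom_add ring_hom_mult ring_hom_one
                   S.l_distr S.r_distr S.m_assoc)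
qed

definition finitely_generated_module ::
    "('a, 'b) ring_scheme \<Rightarrow> ('a, 'c, 'd) module_scheme \<Rightarrow> bool" where
  "finitely_generated_module R M \<longleftrightarrow>
     (\<exists>S. finite S \<and> S \<subseteq> carrier M \<and>
        (\<forall>x\<in>carrier M. \<exists>a\<in>S \<rightarrow> carrier R. x = (\<Oplus>\<^bsub>M\<^esub>s\<in>S. a s \<odot>\<^bsub>M\<^esub> s)))"

definition F_finite :: "('a, 'b) ring_scheme \<Rightarrow> nat \<Rightarrow> bool" where
  "F_finite R p \<longleftrightarrow> finitely_generated_module R (module_via R (\<lambda>r. r [^]\<^bsub>R\<^esub> p))"

definition quotient_length :: "('a, 'b) ring_scheme \<Rightarrow> 'a set \<Rightarrow> enat" where
  "quotient_length R J = module_length R (module_via (R Quot J) (\<lambda>r. J +>\<^bsub>R\<^esub> r))"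

definition frobenius_power :: "('a, 'b) ring_scheme \<Rightarrow> nat \<Rightarrow> 'a set \<Rightarrow> 'a set" where
  "frobenius_power R p J = Idl\<^bsub>R\<^esub> ((\<lambda>a. a [^]\<^bsub>R\<^esub> p) ` J)"

text \<open>
  Families are indexed by \<open>q = p ^ e\<close> itself; the values of \<open>I :: nat \<Rightarrow> 'a set\<close>
  at numbers that are not powers of \<open>p\<close> are irrelevant.
\<close>

definition ideal_family :: "('a, 'b) ring_scheme \<Rightarrow> nat \<Rightarrow> (nat \<Rightarrow> 'a set) \<Rightarrow> bool" where
  "ideal_family R p I \<longleftrightarrow> (\<forall>e. ideal (I (p ^ e)) R)"

definition weakly_inverse_p_family :: "('a, 'b) ring_scheme \<Rightarrow> nat \<Rightarrow> (nat \<Rightarrow> 'a set) \<Rightarrow> bool" where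
  "weakly_inverse_p_family R p I \<longleftrightarrow> ideal_family R p I \<and>
     (\<exists>c\<in>carrier R. c \<noteq> \<zero>\<^bsub>R\<^esub> \<and>
        (\<forall>e. c <#\<^bsub>R\<^esub> I (p * p ^ e) \<subseteq> frobenius_power R p (I (p ^ e))))"

definition weakly_p_family :: "('a, 'b) ring_scheme \<Rightarrow> nat \<Rightarrow> (nat \<Rightarrow> 'a set) \<Rightarrow> bool" where
  "weakly_p_family R p I \<longleftrightarrow> ideal_family R p I \<and>
     (\<exists>c\<in>carrier R. c \<noteq> \<zero>\<^bsub>R\<^esub> \<and>
        (\<forall>e. c <#\<^bsub>R\<^esub> frobenius_power R p (I (p ^ e)) \<subseteq> I (p * p ^ e)))"

text \<open>Powers in \<open>ideals_set R\<close> are the usual powers of ideals.\<close>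

definition BBL :: "('a, 'b) ring_scheme \<Rightarrow> 'a set \<Rightarrow> nat \<Rightarrow> (nat \<Rightarrow> 'a set) \<Rightarrow> bool" where
  "BBL R \<mm> p I \<longleftrightarrow> (\<exists>c::nat. \<forall>e. \<mm> [^]\<^bsub>ideals_set R\<^esub> (c * p ^ e) \<subseteq> I (p ^ e))"

text \<open>
  Extended-real valued, so that an infinite length is not silently turned into a number.
\<close>

definition normalized_length ::
    "('a, 'b) ring_scheme \<Rightarrow> nat \<Rightarrow> (nat \<Rightarrow> 'a set) \<Rightarrow> nat \<Rightarrow> ereal" where
  "normalized_length R d I q = ereal_of_enat (quotient_length R (I q)) / ereal (real q ^ d)"

end

theory Submission
  imports Defs
begin

text \<open>
  Everything takes place inside \<open>R\<close>. Let \<open>S\<close> be the subring of \<open>p\<close>-th powers, so that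
  \<open>F\<^sub>*R\<close> is \<open>R\<close> viewed as an \<open>S\<close>-module, and for an ideal \<open>J\<close> and \<open>p\<close>-th power independent
  \<open>f\<^sub>1, \<dots>, f\<^sub>u\<close> spanning \<open>R\<close> up to torsion put \<open>G\<^sub>J = \<Sum> J\<^sup>[\<^sup>p\<^sup>]f\<^sub>i\<close> (sums of \<open>a\<^sup>p f\<^sub>i\<close> with \<open>a \<in> J\<close>). Then
  \<open>\<ell>\<^sub>S(G\<^sub>R/G\<^sub>J) = u \<ell>\<^sub>R(R/J)\<close>, while \<open>\<ell>\<^sub>S(R/J) = A \<ell>\<^sub>R(R/J)\<close> with \<open>A = [k : k\<^sup>p]\<close>. Multiplication by a
  nonzero element maps \<open>(R, I\<^bsub>pq\<^esub>)\<close> into \<open>(G\<^sub>R, G\<^bsub>I_q\<^esub>)\<close> and, for weak \<open>p\<close>-families, \<open>(G\<^sub>R, G\<^bsub>I_q\<^esub>)\<close> into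
  \<open>(R, I\<^bsub>pq\<^esub>)\<close>. The cokernels have length \<open>O(q\<^bsup>d-1\<^esup>)\<close> because they are killed by a nonzero \<open>y\<close> and by
  \<open>\<mm>\<^bsup>cq\<^esup>\<close>. Hence \<open>A \<ell>(R/I\<^bsub>pq\<^esub>) \<ge> u \<ell>(R/I\<^sub>q) - O(q\<^bsup>d-1\<^esup>)\<close>, with the reverse estimate for weak \<open>p\<close>-families.

  Only \<open>u \<ge> p\<^sup>d A\<close> is needed of Kunz's formula \<open>u = p\<^sup>d A\<close>: if \<open>u > p\<^sup>d A\<close>, boundedness of
  \<open>\<ell>(R/I\<^sub>q)/q\<^sup>d\<close> already forces it to be \<open>O(1/q)\<close>. The inequality follows along a chain of primes: for
  adjacent \<open>Q \<subset> P\<close> and \<open>x \<in> P - Q\<close>, the \<open>P\<close>-local form of the second estimate for the ideals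
  \<open>Q + (x\<^sup>n)\<close>, whose \<open>P\<close>-local colengths are exactly linear in \<open>n\<close>, compares the ranks at \<open>Q\<close> and \<open>P\<close>.
\<close>

no_notation Sum_Type.Plus (infixr "<+>" 65)

subsection \<open>Relative length\<close>

text \<open>Lengths may be infinite, so they are compared through their finite lower bounds; each
  such bound amounts to the existence of one chain.\<close>

lemma enat_leI:
  assumes "\<And>n. enat n \<le> x \<Longrightarrow> enat n \<le> y"
  shows "x \<le> y"
proof (cases x)
  case infinity
  then have "enat (Suc m) \<le> y" for m using assms by simp
  then show ?thesis by (cases y) (use Suc_n_not_le_n in \<open>simp, blast\<close>, simp)
qed (use assms in auto)

lemma enat_eqI: "(\<And>n. enat n \<le> x \<longleftrightarrow> enat n \<le> y) \<Longrightarrow> x = y"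
  by (rule antisym; rule enat_leI; simp)

lemma enat_le_plus_iff:
  "enat n \<le> x + y \<longleftrightarrow> (\<exists>i j. n = i + j \<and> enat i \<le> x \<and> enat j \<le> y)"
proof
  assume *: "enat n \<le> x + y"
  show "\<exists>i j. n = i + j \<and> enat i \<le> x \<and> enat j \<le> y"
  proof (cases "x \<ge> enat n")
    case True
    then show ?thesis by (intro exI[of _ n] exI[of _ 0]) (auto simp: zero_enat_def[symmetric])
  next
    case False
    then obtain k where k: "x = enat k" "k < n"
      by (cases x) auto
    with * have "enat (n - k) \<le> y" by (cases y) auto
    with k show ?thesis by (intro exI[of _ k] exI[of _ "n - k"]) auto
  qed
next
  assume "\<exists>i j. n = i + j \<and> enat i \<le> x \<and> enat j \<le> y"
  then show "enat n \<le> x + y"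
    by (metis add_mono plus_enat_simps(1))
qed

context cring begin

text \<open>Additive inverses are not listed: for the sets \<open>S\<close> in use they come from
  \<open>\<ominus> \<one> \<in> S\<close>, see \<open>submod_uminus\<close>.\<close>

definition submod :: "'a set \<Rightarrow> 'a set \<Rightarrow> bool" where
  "submod S N \<longleftrightarrow> N \<subseteq> carrier R \<and> \<zero> \<in> N \<and> (\<forall>x\<in>N. \<forall>y\<in>N. x \<oplus> y \<in> N) \<and>
     (\<forall>s\<in>S. \<forall>x\<in>N. s \<otimes> x \<in> N)"

text \<open>\<open>S\<close> is the set that acts (later the whole ring, or the ring of p-th
  powers), and \<open>Y\<close> is the multiplicative set that gets inverted.\<close>

definition scalars :: "'a set \<Rightarrow> 'a set \<Rightarrow> bool" where
  "scalars S Y \<longleftrightarrow> S \<subseteq> carrier R \<and> \<ominus> \<one> \<in> S \<and> Y \<subseteq> S \<and> \<one> \<in> Y \<and>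
     (\<forall>y\<in>Y. \<forall>y'\<in>Y. y \<otimes> y' \<in> Y)"

text \<open>
  \<open>absorbs Y A B\<close> says that \<open>B \<subseteq> A\<close> after inverting \<open>Y\<close>. Counting only the steps that are strict in
  this sense makes \<open>rel_length S Y A B\<close> the length of the localisation of \<open>B/A\<close> at \<open>Y\<close>, with neither
  quotients nor fractions.
\<close>

definition absorbs :: "'a set \<Rightarrow> 'a set \<Rightarrow> 'a set \<Rightarrow> bool" where
  "absorbs Y A B \<longleftrightarrow> (\<forall>b\<in>B. \<exists>y\<in>Y. y \<otimes> b \<in> A)"

primrec strict_chain :: "'a set \<Rightarrow> 'a set \<Rightarrow> nat \<Rightarrow> 'a set \<Rightarrow> 'a set \<Rightarrow> bool" where
  "strict_chain S Y 0 A B \<longleftrightarrow> A \<subseteq> B"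
| "strict_chain S Y (Suc n) A B \<longleftrightarrow>
     (\<exists>D. submod S D \<and> A \<subseteq> D \<and> D \<subseteq> B \<and> \<not> absorbs Y A D \<and> strict_chain S Y n D B)"

definition rel_length :: "'a set \<Rightarrow> 'a set \<Rightarrow> 'a set \<Rightarrow> 'a set \<Rightarrow> enat" where
  "rel_length S Y A B = Sup {enat n | n. strict_chain S Y n A B}"

lemma submodD:
  assumes "submod S N"
  shows "N \<subseteq> carrier R" "\<zero> \<in> N" "\<And>x y. x \<in> N \<Longrightarrow> y \<in> N \<Longrightarrow> x \<oplus> y \<in> N"
    "\<And>s x. s \<in> S \<Longrightarrow> x \<in> N \<Longrightarrow> s \<otimes> x \<in> N" "\<And>x. x \<in> N \<Longrightarrow> x \<in> carrier R"
  using assms unfolding submod_def by auto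

lemma submodI:
  assumes "N \<subseteq> carrier R" "\<zero> \<in> N" "\<And>x y. x \<in> N \<Longrightarrow> y \<in> N \<Longrightarrow> x \<oplus> y \<in> N"
    "\<And>s x. s \<in> S \<Longrightarrow> x \<in> N \<Longrightarrow> s \<otimes> x \<in> N"
  shows "submod S N"
  using assms unfolding submod_def by auto

lemma scalarsD:
  assumes "scalars S Y"
  shows "S \<subseteq> carrier R" "\<ominus> \<one> \<in> S" "Y \<subseteq> S" "\<one> \<in> Y"
    "\<And>y y'. y \<in> Y \<Longrightarrow> y' \<in> Y \<Longrightarrow> y \<otimes> y' \<in> Y" "\<And>y. y \<in> Y \<Longrightarrow> y \<in> S"
    "\<And>y. y \<in> S \<Longrightarrow> y \<in> carrier R" "\<And>y. y \<in> Y \<Longrightarrow> y \<in> carrier R"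
  using assms unfolding scalars_def by auto

lemma submod_uminus:
  assumes "scalars S Y" "submod S N" "x \<in> N"
  shows "\<ominus> x \<in> N"
proof -
  have "\<ominus> \<one> \<otimes> x \<in> N"
    using assms by (auto simp: submod_def scalars_def)
  then show ?thesis
    using submodD(5)[OF assms(2,3)] by (simp add: l_minus)
qed

lemma submod_minus:
  assumes "scalars S Y" "submod S N" "x \<in> N" "y \<in> N"
  shows "x \<ominus> y \<in> N"
  unfolding a_minus_def using assms submod_uminus submodD(3) by meson

lemma add_minus_cancel_left:
  assumes "a \<in> carrier R" "b \<in> carrier R"
  shows "a \<oplus> b \<ominus> a = b"
  unfolding a_minus_def a_comm[OF assms] using assms by (simp add: a_assoc r_neg)

lemma mem_set_add_iff: "x \<in> A <+> B \<longleftrightarrow> (\<exists>a\<in>A. \<exists>b\<in>B. x = a \<oplus> b)"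
  by (auto simp: set_add_def' )

lemma set_addI: "a \<in> A \<Longrightarrow> b \<in> B \<Longrightarrow> a \<oplus> b \<in> A <+> B"
  by (auto simp: mem_set_add_iff)

lemma set_add_mono: "A \<subseteq> A' \<Longrightarrow> B \<subseteq> B' \<Longrightarrow> A <+> B \<subseteq> A' <+> B'"
  unfolding set_add_def' by blast

lemma submod_Int: "submod S A \<Longrightarrow> submod S B \<Longrightarrow> submod S (A \<inter> B)"
  by (auto simp: submod_def)

lemma submod_set_add:
  assumes "S \<subseteq> carrier R" "submod S A" "submod S B"
  shows "submod S (A <+> B)"
proof (rule submodI)
  note A = submodD[OF assms(2)] and B = submodD[OF assms(3)]
  show "A <+> B \<subseteq> carrier R"
    using A B by (auto simp: mem_set_add_iff)
  show "\<zero> \<in> A <+> B"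
    using A(2) B(2) by (auto simp: mem_set_add_iff intro!: bexI[of _ \<zero>])
  fix x y assume "x \<in> A <+> B" "y \<in> A <+> B"
  then obtain a b a' b' where "a \<in> A" "b \<in> B" "a' \<in> A" "b' \<in> B" "x = a \<oplus> b" "y = a' \<oplus> b'"
    by (auto simp: mem_set_add_iff)
  moreover from this have "x \<oplus> y = (a \<oplus> a') \<oplus> (b \<oplus> b')"
    using A(5) B(5) by (simp add: a_ac)
  ultimately show "x \<oplus> y \<in> A <+> B"
    using A(3) B(3) set_addI by metis
next
  note A = submodD[OF assms(2)] and B = submodD[OF assms(3)]
  fix s x assume s: "s \<in> S" and "x \<in> A <+> B"
  then obtain a b where *: "a \<in> A" "b \<in> B" "x = a \<oplus> b"
    by (auto simp: mem_set_add_iff)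
  then have "s \<otimes> x = s \<otimes> a \<oplus> s \<otimes> b"
    using A(5) B(5) s assms(1) by (auto simp: r_distr)
  then show "s \<otimes> x \<in> A <+> B"
    using A(4) B(4) s * set_addI by metis
qed

lemma subset_set_add:
  assumes "A \<subseteq> carrier R" "\<zero> \<in> B"
  shows "A \<subseteq> A <+> B"
  using assms by (force simp: mem_set_add_iff)

lemma set_add_least:
  assumes "submod S N" "A \<subseteq> N" "B \<subseteq> N"
  shows "A <+> B \<subseteq> N"
  using submodD(3)[OF assms(1)] assms(2,3) by (force simp: mem_set_add_iff)

lemma set_add_commute: "A \<subseteq> carrier R \<Longrightarrow> B \<subseteq> carrier R \<Longrightarrow> A <+> B = B <+> A"
  by (auto simp: set_eq_iff mem_set_add_iff) (metis a_comm subsetD)+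

lemma absorbs_mono: "absorbs Y A B \<Longrightarrow> A \<subseteq> A' \<Longrightarrow> B' \<subseteq> B \<Longrightarrow> absorbs Y A' B'"
  unfolding absorbs_def by blast

lemma strict_chain_subset: "strict_chain S Y n A B \<Longrightarrow> A \<subseteq> B"
  by (cases n) auto

lemma strict_chain_mono:
  "strict_chain S Y n A B \<Longrightarrow> A' \<subseteq> A \<Longrightarrow> B \<subseteq> B' \<Longrightarrow> strict_chain S Y n A' B'"
proof (induction n arbitrary: A A')
  case (Suc n)
  then obtain D where D: "submod S D" "A \<subseteq> D" "D \<subseteq> B" "\<not> absorbs Y A D" "strict_chain S Y n D B"
    by auto
  have "\<not> absorbs Y A' D"
    using D(4) absorbs_mono Suc.prems by blast
  then show ?case
    using D Suc.IH[OF D(5) order_refl Suc.prems(3)] Suc.prems by fastforce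
qed auto

lemma strict_chain_Suc_imp: "strict_chain S Y (Suc n) A B \<Longrightarrow> strict_chain S Y n A B"
  using strict_chain_mono by (metis order_refl strict_chain.simps(2))

lemma strict_chain_le: "m \<le> n \<Longrightarrow> strict_chain S Y n A B \<Longrightarrow> strict_chain S Y m A B"
  by (induction n rule: dec_induct) (use strict_chain_Suc_imp in blast)+

text \<open>Chains can be shortened, so the lengths that occur form an initial segment, and a finite
  lower bound of the supremum is attained. Without \<open>A \<subseteq> B\<close> the case n = 0
  fails, the empty supremum being 0.\<close>

lemma enat_le_rel_length_iff:
  assumes "A \<subseteq> B"
  shows "enat n \<le> rel_length S Y A B \<longleftrightarrow> strict_chain S Y n A B"
proof
  assume le: "enat n \<le> rel_length S Y A B"
  show "strict_chain S Y n A B"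
  proof (rule ccontr)
    assume not: "\<not> strict_chain S Y n A B"
    then have n: "n > 0"
      using assms by (cases n) auto
    have "m < n" if "strict_chain S Y m A B" for m
      using strict_chain_le not that by (meson not_le)
    then have "rel_length S Y A B \<le> enat (n - 1)"
      unfolding rel_length_def by (force intro!: Sup_least)
    with le n show False
      by (metis diff_less enat_ord_simps(1) less_numeral_extra(1) linorder_not_less order_trans)
  qed
qed (auto simp: rel_length_def intro: Sup_upper)

lemma rel_length_mono:
  assumes "A \<subseteq> A'" "B' \<subseteq> B"
  shows "rel_length S Y A' B' \<le> rel_length S Y A B"
  unfolding rel_length_def using strict_chain_mono[OF _ assms]
  by (intro Sup_subset_mono) auto

lemma strict_chain_append:
  "strict_chain S Y i A B \<Longrightarrow> strict_chain S Y j B C \<Longrightarrow> strict_chain S Y (i + j) A C"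
proof (induction i arbitrary: A)
  case 0
  then show ?case using strict_chain_mono by auto
next
  case (Suc i)
  then obtain D where D: "submod S D" "A \<subseteq> D" "D \<subseteq> B" "\<not> absorbs Y A D" "strict_chain S Y i D B"
    by auto
  moreover have "D \<subseteq> C" using strict_chain_subset Suc.prems(2) D(3) by blast
  ultimately show ?case
    using Suc.IH[OF D(5) Suc.prems(2)] by auto
qed

text \<open>The modular law after inverting \<open>Y\<close>: from y d = a + n one gets n = y d - a
  in D \<inter> N, a further factor y' moves n into A, and then y' y d lies in A.\<close>

lemma absorbs_modular:
  assumes S: "scalars S Y" and "submod S A" "submod S D" "submod S N" "A \<subseteq> D"
    and int: "absorbs Y (A \<inter> N) (D \<inter> N)" and sum: "absorbs Y (A <+> N) (D <+> N)"
  shows "absorbs Y A D"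
  unfolding absorbs_def
proof
  note c = submodD(5)[OF assms(2)] submodD(5)[OF assms(3)] submodD(5)[OF assms(4)] scalarsD(8)[OF S]
  fix d assume d: "d \<in> D"
  then have "d \<in> D <+> N"
    using subset_set_add[OF submodD(1)[OF assms(3)] submodD(2)[OF assms(4)]] by blast
  then obtain y where y: "y \<in> Y" "y \<otimes> d \<in> A <+> N"
    using sum by (auto simp: absorbs_def)
  then obtain a n where an: "a \<in> A" "n \<in> N" "y \<otimes> d = a \<oplus> n"
    by (auto simp: mem_set_add_iff)
  have "y \<otimes> d \<in> D" "a \<in> D"
    using submodD(4)[OF assms(3) scalarsD(6)[OF S y(1)] d] an assms by auto
  then have "y \<otimes> d \<ominus> a \<in> D"
    using submod_minus S assms by blast
  also have "y \<otimes> d \<ominus> a = n"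
    using an c by (simp add: add_minus_cancel_left)
  finally have "n \<in> D \<inter> N" using an by auto
  then obtain y' where y': "y' \<in> Y" "y' \<otimes> n \<in> A"
    using int by (auto simp: absorbs_def)
  have "(y' \<otimes> y) \<otimes> d = y' \<otimes> a \<oplus> y' \<otimes> n"
    using an y y' c d by (simp add: m_assoc r_distr)
  moreover have "y' \<otimes> a \<in> A"
    using submodD(4)[OF assms(2)] y' an scalarsD(6)[OF S] by auto
  ultimately have "(y' \<otimes> y) \<otimes> d \<in> A"
    using submodD(3)[OF assms(2)] y' by auto
  then show "\<exists>y\<in>Y. y \<otimes> d \<in> A"
    using scalarsD(5)[OF S] y y' by blast
qed

text \<open>By the modular law a strict step remains strict after intersecting with \<open>N\<close>
  or after adding \<open>N\<close>, so each step can be charged to one of the two sides.\<close>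

lemma strict_chain_split:
  assumes S: "scalars S Y" and N: "submod S N" and C: "submod S C"
  shows "strict_chain S Y n A C \<Longrightarrow> submod S A \<Longrightarrow>
    \<exists>i j. n = i + j \<and> strict_chain S Y i (A \<inter> N) (C \<inter> N) \<and> strict_chain S Y j (A <+> N) (C <+> N)"
proof (induction n arbitrary: A)
  case 0
  then show ?case using set_add_mono[of A C N N] by auto
next
  case (Suc n)
  then obtain D where D: "submod S D" "A \<subseteq> D" "D \<subseteq> C" "\<not> absorbs Y A D" "strict_chain S Y n D C"
    by auto
  then obtain i j where ij: "n = i + j" "strict_chain S Y i (D \<inter> N) (C \<inter> N)"
      "strict_chain S Y j (D <+> N) (C <+> N)"
    using Suc.IH by blast
  have sub: "A \<inter> N \<subseteq> D \<inter> N" "A <+> N \<subseteq> D <+> N" "D \<inter> N \<subseteq> C \<inter> N" "D <+> N \<subseteq> C <+> N"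
    using D set_add_mono by auto
  show ?case
  proof (cases "absorbs Y (A \<inter> N) (D \<inter> N)")
    case False
    then have "strict_chain S Y (Suc i) (A \<inter> N) (C \<inter> N)"
      using ij sub D N submod_Int by (auto intro!: exI[of _ "D \<inter> N"])
    moreover have "strict_chain S Y j (A <+> N) (C <+> N)"
      using ij sub strict_chain_mono by blast
    ultimately show ?thesis using ij by (intro exI[of _ "Suc i"] exI[of _ j]) auto
  next
    case True
    then have "\<not> absorbs Y (A <+> N) (D <+> N)"
      using absorbs_modular[OF S Suc.prems(2) D(1) N D(2)] D by blast
    then have "strict_chain S Y (Suc j) (A <+> N) (C <+> N)"
      using ij sub D N submod_set_add scalarsD(1)[OF S] by (auto intro!: exI[of _ "D <+> N"])
    moreover have "strict_chain S Y i (A \<inter> N) (C \<inter> N)"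
      using ij sub strict_chain_mono by blast
    ultimately show ?thesis using ij by (intro exI[of _ i] exI[of _ "Suc j"]) auto
  qed
qed

lemma set_add_absorb:
  assumes "submod S N" "\<zero> \<in> A" "A \<subseteq> N"
  shows "A <+> N = N"
proof
  show "A <+> N \<subseteq> N" using set_add_least[OF assms(1,3) order_refl] .
  show "N \<subseteq> A <+> N"
    using set_addI[OF assms(2)] submodD(5)[OF assms(1)] by fastforce
qed

text \<open>The splitting lemma gives one inequality, because its two chains then run from A to N
  and from N to C; concatenating chains gives the other.\<close>

lemma rel_length_add:
  assumes S: "scalars S Y" and "submod S A" "submod S N" "submod S C" and sub: "A \<subseteq> N" "N \<subseteq> C"
  shows "rel_length S Y A C = rel_length S Y A N + rel_length S Y N C"
proof (rule enat_eqI)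
  fix n
  have "A \<inter> N = A" "C \<inter> N = N" using sub by auto
  moreover have "A <+> N = N"
    using set_add_absorb[OF assms(3) submodD(2)[OF assms(2)] sub(1)] .
  moreover have "C <+> N = C"
    using set_add_absorb[OF assms(4) submodD(2)[OF assms(3)] sub(2)]
      set_add_commute[OF submodD(1)[OF assms(4)] submodD(1)[OF assms(3)]] by simp
  ultimately have "strict_chain S Y n A C \<longleftrightarrow>
      (\<exists>i j. n = i + j \<and> strict_chain S Y i A N \<and> strict_chain S Y j N C)"
    using strict_chain_split[OF S assms(3,4) _ assms(2), of n] strict_chain_append by fastforce
  then show "enat n \<le> rel_length S Y A C \<longleftrightarrow> enat n \<le> rel_length S Y A N + rel_length S Y N C"
    using sub by (simp add: enat_le_rel_length_iff enat_le_plus_iff)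
qed

lemma rel_length_ge_1_iff:
  assumes "submod S B" "A \<subseteq> B"
  shows "1 \<le> rel_length S Y A B \<longleftrightarrow> \<not> absorbs Y A B"
proof -
  have "1 \<le> rel_length S Y A B \<longleftrightarrow> strict_chain S Y 1 A B"
    using enat_le_rel_length_iff[OF assms(2), of 1] by (simp add: one_enat_def)
  also have "\<dots> \<longleftrightarrow> \<not> absorbs Y A B"
    using assms absorbs_mono by (auto simp: One_nat_def)
  finally show ?thesis .
qed

lemma rel_length_eq_0_iff:
  assumes "submod S B" "A \<subseteq> B"
  shows "rel_length S Y A B = 0 \<longleftrightarrow> absorbs Y A B"
  using rel_length_ge_1_iff[OF assms, of Y] by (cases "rel_length S Y A B") (auto simp: one_enat_def zero_enat_def)

section \<open>Transport of chains along semilinear maps\<close>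

lemma strict_chain_map:
  assumes T: "\<And>D. submod S1 D \<Longrightarrow> A \<subseteq> D \<Longrightarrow> D \<subseteq> B \<Longrightarrow> submod S2 (T D)"
      "\<And>D E. submod S1 D \<Longrightarrow> submod S1 E \<Longrightarrow> A \<subseteq> D \<Longrightarrow> D \<subseteq> E \<Longrightarrow> E \<subseteq> B \<Longrightarrow>
         T D \<subseteq> T E \<and> (absorbs Y2 (T D) (T E) \<longrightarrow> absorbs Y1 D E)"
    and A: "submod S1 A" "submod S1 B"
  shows "strict_chain S1 Y1 n A B \<Longrightarrow> strict_chain S2 Y2 n (T A) (T B)"
  using T A
proof (induction n arbitrary: A)
  case 0
  then show ?case by auto
next
  case (Suc n)
  from Suc.prems(1) obtain D where D: "submod S1 D" "A \<subseteq> D" "D \<subseteq> B" "\<not> absorbs Y1 A D"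
      "strict_chain S1 Y1 n D B" by auto
  have "strict_chain S2 Y2 n (T D) (T B)"
    using Suc.prems D by (intro Suc.IH[OF D(5)]) auto
  moreover have "submod S2 (T D)" using Suc.prems(2) D by blast
  moreover have "T A \<subseteq> T D" "\<not> absorbs Y2 (T A) (T D)" "T D \<subseteq> T B"
    using Suc.prems(3)[of A D] Suc.prems(3)[of D B] Suc.prems(4,5) D by auto
  ultimately show ?case by (auto intro!: exI[of _ "T D"])
qed

text \<open>The isomorphism theorem for M modulo the preimage of B and (B + \<phi>(M))/B, with
  chains carried by D \<mapsto> B + \<phi>(D) and by preimages. Semilinearity along
  \<open>\<tau>\<close> lets the scalars pass from R to its p-th powers.\<close>

lemma rel_length_map:
  assumes S1: "scalars S1 Y1" and S2: "scalars S2 Y2" and M: "submod S1 M" and B: "submod S2 B"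
    and \<phi>: "\<And>a. a \<in> M \<Longrightarrow> \<phi> a \<in> carrier R"
      "\<And>a b. a \<in> M \<Longrightarrow> b \<in> M \<Longrightarrow> \<phi> (a \<oplus> b) = \<phi> a \<oplus> \<phi> b"
      "\<And>s a. s \<in> S1 \<Longrightarrow> a \<in> M \<Longrightarrow> \<phi> (s \<otimes> a) = \<tau> s \<otimes> \<phi> a"
    and \<tau>: "\<tau> ` S1 = S2" "\<tau> ` Y1 = Y2"
  shows "rel_length S1 Y1 {a \<in> M. \<phi> a \<in> B} M = rel_length S2 Y2 B (B <+> \<phi> ` M)"
proof -
  define A where "A = {a \<in> M. \<phi> a \<in> B}"
  define T where "T D = B <+> \<phi> ` D" for D
  define U where "U E = {a \<in> M. \<phi> a \<in> E}" for E
  note Mc = submodD(5)[OF M] and Bc = submodD(5)[OF B]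
  have \<phi>0: "\<phi> \<zero> = \<zero>"
    using \<phi>(1)[of \<zero>] \<phi>(2)[of \<zero> \<zero>] submodD(2)[OF M]
    by (metis add.l_cancel_one' r_zero zero_closed)
  have \<phi>m: "\<phi> (a \<ominus> b) = \<phi> a \<ominus> \<phi> b" if "a \<in> M" "b \<in> M" for a b
  proof -
    have "a \<ominus> b \<in> M" using submod_minus S1 M that by blast
    moreover have "(a \<ominus> b) \<oplus> b = a" using that Mc by (simp add: a_minus_def a_assoc l_neg)
    ultimately have "\<phi> a = \<phi> (a \<ominus> b) \<oplus> \<phi> b" using \<phi>(2) that by metis
    then show ?thesis using \<phi>(1) that \<open>a \<ominus> b \<in> M\<close> by (simp add: a_minus_def a_assoc r_neg)
  qed
  have img: "submod S2 (\<phi> ` D)" if "submod S1 D" "D \<subseteq> M" for D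
  proof (rule submodI)
    show "\<phi> ` D \<subseteq> carrier R" using \<phi>(1) that by auto
    show "\<zero> \<in> \<phi> ` D" using \<phi>0 submodD(2)[OF that(1)] by force
    fix x y assume "x \<in> \<phi> ` D" "y \<in> \<phi> ` D"
    then obtain a b where ab: "x = \<phi> a" "y = \<phi> b" "a \<in> D" "b \<in> D" by auto
    then have "x \<oplus> y = \<phi> (a \<oplus> b)" using \<phi>(2)[OF subsetD subsetD, OF that(2) _ that(2)] by simp
    then show "x \<oplus> y \<in> \<phi> ` D" using submodD(3)[OF that(1) ab(3,4)] by blast
  next
    fix s x assume "s \<in> S2" "x \<in> \<phi> ` D"
    then obtain t a where ta: "s = \<tau> t" "t \<in> S1" "x = \<phi> a" "a \<in> D" using \<tau>(1) by auto
    then have "s \<otimes> x = \<phi> (t \<otimes> a)" using \<phi>(3)[OF ta(2) subsetD, OF that(2)] by simp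
    then show "s \<otimes> x \<in> \<phi> ` D" using submodD(4)[OF that(1) ta(2,4)] by blast
  qed
  have T: "submod S2 (T D)" if "submod S1 D" "D \<subseteq> M" for D
    unfolding T_def using submod_set_add scalarsD(1)[OF S2] B img that by blast
  have U: "submod S1 (U E)" if "submod S2 E" for E
  proof (rule submodI)
    show "U E \<subseteq> carrier R" using submodD(1)[OF M] by (auto simp: U_def)
    show "\<zero> \<in> U E" using submodD(2)[OF that] submodD(2)[OF M] \<phi>0 by (simp add: U_def)
    show "x \<oplus> y \<in> U E" if "x \<in> U E" "y \<in> U E" for x y
      using that submodD(3)[OF \<open>submod S2 E\<close>] submodD(3)[OF M] \<phi>(2) by (simp add: U_def)
    show "s \<otimes> x \<in> U E" if "s \<in> S1" "x \<in> U E" for s x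
      using that submodD(4)[OF \<open>submod S2 E\<close>, of "\<tau> s"] submodD(4)[OF M] \<phi>(3) \<tau>(1)
      by (auto simp: U_def)
  qed
  have A: "submod S1 A" using U[OF B] by (simp add: U_def A_def)
  have TA: "T A = B"
  proof
    show "T A \<subseteq> B" unfolding T_def using set_add_least[OF B order_refl, of "\<phi> ` A"] by (auto simp: A_def)
    have "\<zero> \<in> \<phi> ` A"
      using \<phi>0 submodD(2)[OF B] submodD(2)[OF M] by (force simp: A_def)
    then show "B \<subseteq> T A"
      unfolding T_def using subset_set_add submodD(1)[OF B] by blast
  qed
  have \<phi>T: "\<phi> a \<in> T D" if "a \<in> D" "D \<subseteq> M" for a D
    unfolding T_def using set_addI[OF submodD(2)[OF B], of "\<phi> a" "\<phi> ` D"] \<phi>(1)[of a] that by auto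
  have UT: "U (T M) = M"
    unfolding U_def using \<phi>T[of _ M] by auto
  have "strict_chain S2 Y2 n (T A) (T M)" if "strict_chain S1 Y1 n A M" for n
  proof (rule strict_chain_map[OF _ _ _ M that])
    fix D E assume DE: "submod S1 D" "submod S1 E" "A \<subseteq> D" "D \<subseteq> E" "E \<subseteq> M"
    have "absorbs Y1 D E" if ab: "absorbs Y2 (T D) (T E)"
      unfolding absorbs_def
    proof
      fix e assume e: "e \<in> E"
      then have "\<phi> e \<in> T E"
        using \<phi>T DE by blast
      then obtain y where y: "y \<in> Y1" "\<tau> y \<otimes> \<phi> e \<in> T D"
        using ab \<tau>(2) by (force simp: absorbs_def)
      have eM: "e \<in> M" using e DE by auto
      have ye: "y \<otimes> e \<in> M" using submodD(4)[OF M] eM y scalarsD(6)[OF S1] by auto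
      obtain b d where bd: "b \<in> B" "d \<in> D" "\<tau> y \<otimes> \<phi> e = b \<oplus> \<phi> d"
        using y(2) unfolding T_def mem_set_add_iff by auto
      have d: "d \<in> M" using bd DE by auto
      have "\<phi> (y \<otimes> e \<ominus> d) = (b \<oplus> \<phi> d) \<ominus> \<phi> d"
        using \<phi>m[OF ye d] \<phi>(3)[OF scalarsD(6)[OF S1 y(1)] eM] bd by simp
      also have "\<dots> = b"
        using Bc \<phi>(1) bd d by (simp add: a_minus_def a_assoc r_neg)
      \<comment> \<open>The images of y e and d differ only by an element of B, so y e - d falls
        into A, which is contained in D.\<close>
      finally have "y \<otimes> e \<ominus> d \<in> A"
        using bd submod_minus[OF S1 M ye d] by (simp add: A_def)
      then have "(y \<otimes> e \<ominus> d) \<oplus> d \<in> D"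
        using submodD(3)[OF DE(1)] DE bd by blast
      then have "y \<otimes> e \<in> D"
        using Mc ye d by (simp add: a_minus_def a_assoc l_neg)
      then show "\<exists>y\<in>Y1. y \<otimes> e \<in> D" using y by auto
    qed
    moreover have "T D \<subseteq> T E" unfolding T_def using DE(4) by (intro set_add_mono image_mono order_refl)
    ultimately show "T D \<subseteq> T E \<and> (absorbs Y2 (T D) (T E) \<longrightarrow> absorbs Y1 D E)" by blast
  qed (use T A in auto)
  moreover have "strict_chain S1 Y1 n (U B) (U (T M))" if "strict_chain S2 Y2 n B (T M)" for n
  proof (rule strict_chain_map[OF _ _ B T[OF M order_refl] that])
    fix D E assume DE: "submod S2 D" "submod S2 E" "B \<subseteq> D" "D \<subseteq> E" "E \<subseteq> T M"
    have "absorbs Y2 D E" if ab: "absorbs Y1 (U D) (U E)"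
      unfolding absorbs_def
    proof
      fix e assume e: "e \<in> E"
      then have "e \<in> B <+> \<phi> ` M" using DE(5) by (auto simp: T_def)
      then obtain b m where bm: "b \<in> B" "m \<in> M" "e = b \<oplus> \<phi> m"
        unfolding mem_set_add_iff by auto
      have "e \<ominus> b \<in> E" using submod_minus[OF S2 DE(2)] e bm DE by blast
      moreover have "e \<ominus> b = \<phi> m"
        using bm Bc \<phi>(1) by (simp add: add_minus_cancel_left)
      ultimately have "m \<in> U E" using bm by (simp add: U_def)
      then obtain y where y: "y \<in> Y1" "y \<otimes> m \<in> U D" using ab by (auto simp: absorbs_def)
      have \<tau>y: "\<tau> y \<in> Y2" using \<tau> y by auto
      have "\<tau> y \<otimes> \<phi> m \<in> D"
        using y \<phi>(3)[OF scalarsD(6)[OF S1 y(1)] bm(2)] by (simp add: U_def)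
      moreover have "\<tau> y \<otimes> b \<in> D"
        using submodD(4)[OF DE(1)] scalarsD(6)[OF S2 \<tau>y] bm DE by blast
      moreover have "\<tau> y \<otimes> e = \<tau> y \<otimes> b \<oplus> \<tau> y \<otimes> \<phi> m"
        using bm Bc \<phi>(1) scalarsD(8)[OF S2 \<tau>y] by (simp add: r_distr)
      ultimately have "\<tau> y \<otimes> e \<in> D" using submodD(3)[OF DE(1)] by auto
      then show "\<exists>y\<in>Y2. y \<otimes> e \<in> D" using \<tau>y by blast
    qed
    then show "U D \<subseteq> U E \<and> (absorbs Y1 (U D) (U E) \<longrightarrow> absorbs Y2 D E)"
      using DE by (auto simp: U_def)
  qed (use U in auto)
  ultimately have "strict_chain S1 Y1 n A M \<longleftrightarrow> strict_chain S2 Y2 n B (T M)" for n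
    using TA UT by (metis A_def U_def)
  then show ?thesis unfolding rel_length_def A_def T_def by simp
qed

subsection \<open>Lengths of ideals localised at a prime\<close>

lemma submod_carrier_iff: "submod (carrier R) J \<longleftrightarrow> ideal J R"
proof
  assume J: "submod (carrier R) J"
  show "ideal J R"
  proof (intro idealI ring_axioms add.subgroupI)
    show "J \<noteq> {}" using submodD(2)[OF J] by auto
    show "\<ominus> a \<in> J" if "a \<in> J" for a
    proof -
      have "\<ominus> \<one> \<otimes> a \<in> J" using submodD(4)[OF J _ that] by simp
      then show ?thesis using submodD(5)[OF J that] by (simp add: l_minus)
    qed
    show "x \<otimes> a \<in> J" "a \<otimes> x \<in> J" if "a \<in> J" "x \<in> carrier R" for a x
      using submodD(4)[OF J that(2,1)] submodD(5)[OF J that(1)] that m_comm by auto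
  qed (use submodD[OF J] in auto)
next
  assume "ideal J R"
  then interpret ideal J R .
  show "submod (carrier R) J"
    by (rule submodI) (auto simp: I_l_closed)
qed

lemma idealD:
  assumes "ideal J R"
  shows "J \<subseteq> carrier R" "\<zero> \<in> J" "\<And>x y. x \<in> J \<Longrightarrow> y \<in> J \<Longrightarrow> x \<oplus> y \<in> J"
    "\<And>s x. s \<in> carrier R \<Longrightarrow> x \<in> J \<Longrightarrow> s \<otimes> x \<in> J" "\<And>x. x \<in> J \<Longrightarrow> x \<in> carrier R"
    "\<And>s x. s \<in> carrier R \<Longrightarrow> x \<in> J \<Longrightarrow> x \<otimes> s \<in> J"
    "\<And>x y. x \<in> J \<Longrightarrow> y \<in> J \<Longrightarrow> x \<ominus> y \<in> J"
proof -
  interpret ideal J R by fact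
  show "J \<subseteq> carrier R" "\<zero> \<in> J" "\<And>x y. x \<in> J \<Longrightarrow> y \<in> J \<Longrightarrow> x \<oplus> y \<in> J"
    "\<And>s x. s \<in> carrier R \<Longrightarrow> x \<in> J \<Longrightarrow> s \<otimes> x \<in> J" "\<And>x. x \<in> J \<Longrightarrow> x \<in> carrier R"
    "\<And>s x. s \<in> carrier R \<Longrightarrow> x \<in> J \<Longrightarrow> x \<otimes> s \<in> J"
    "\<And>x y. x \<in> J \<Longrightarrow> y \<in> J \<Longrightarrow> x \<ominus> y \<in> J"
    by (auto simp: I_l_closed I_r_closed a_minus_def)
qed

lemma primeD:
  assumes "primeideal P R"
  shows "ideal P R" "\<one> \<notin> P"
    "\<And>a b. a \<in> carrier R \<Longrightarrow> b \<in> carrier R \<Longrightarrow> a \<otimes> b \<in> P \<Longrightarrow> a \<in> P \<or> b \<in> P"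
proof -
  interpret primeideal P R by fact
  show "ideal P R" by (rule is_ideal)
  show "\<one> \<notin> P" using I_notcarr one_imp_carrier by blast
  show "\<And>a b. a \<in> carrier R \<Longrightarrow> b \<in> carrier R \<Longrightarrow> a \<otimes> b \<in> P \<Longrightarrow> a \<in> P \<or> b \<in> P"
    by (rule I_prime)
qed

lemma scalars_prime: "primeideal P R \<Longrightarrow> scalars (carrier R) (carrier R - P)"
  using primeD[of P] unfolding scalars_def by blast

lemma prime_pow_notin: "primeideal P R \<Longrightarrow> x \<in> carrier R \<Longrightarrow> x \<notin> P \<Longrightarrow> x [^] (n::nat) \<notin> P"
  by (induction n) (auto dest: primeD(2,3))

text \<open>For ideals A \<subseteq> B this is the length of (B/A)_P over the local ring
  R_P.\<close>

definition lenR :: "'a set \<Rightarrow> 'a set \<Rightarrow> 'a set \<Rightarrow> enat" where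
  "lenR P = rel_length (carrier R) (carrier R - P)"

lemma mem_cgenideal_iff: "x \<in> carrier R \<Longrightarrow> y \<in> PIdl x \<longleftrightarrow> (\<exists>r\<in>carrier R. y = x \<otimes> r)"
  unfolding cgenideal_def by (auto simp: m_comm)

lemma image_mult_carrier: "x \<in> carrier R \<Longrightarrow> (\<otimes>) x ` carrier R = PIdl x"
  by (auto simp: mem_cgenideal_iff)

lemma rel_length_mult:
  assumes "scalars S Y" "submod S M" "submod S B" "x \<in> carrier R"
  shows "rel_length S Y {a \<in> M. x \<otimes> a \<in> B} M = rel_length S Y B (B <+> (\<otimes>) x ` M)"
proof (rule rel_length_map[where \<tau> = id])
  fix s a assume "s \<in> S" "a \<in> M"
  then show "x \<otimes> (s \<otimes> a) = id s \<otimes> (x \<otimes> a)"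
    using assms submodD(5) scalarsD(7)[OF assms(1)] m_lcomm by auto
qed (use assms submodD(5)[OF assms(2)] in \<open>auto simp: r_distr\<close>)

lemma colon_ideal: "ideal J R \<Longrightarrow> a \<in> carrier R \<Longrightarrow> ideal {r \<in> carrier R. a \<otimes> r \<in> J} R"
  unfolding submod_carrier_iff[symmetric]
  by (rule submodI) (auto simp: r_distr m_lcomm dest: submodD)

lemma rel_length_refl:
  assumes "scalars S Y" "submod S A"
  shows "rel_length S Y A A = 0"
  using rel_length_eq_0_iff[OF assms(2) order_refl, of Y] assms
    scalarsD(4)[OF assms(1)] submodD(5)[OF assms(2)]
  by (auto simp: absorbs_def intro!: bexI[of _ \<one>])

text \<open>Additivity along J \<subseteq> J + aR \<subseteq> R; multiplication by a identifies R/(J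
  : a) with (J + aR)/J.\<close>

lemma lenR_colon:
  assumes P: "primeideal P R" and J: "ideal J R" and a: "a \<in> carrier R"
  shows "lenR P J (carrier R) =
    lenR P {r \<in> carrier R. a \<otimes> r \<in> J} (carrier R) + lenR P (J <+> PIdl a) (carrier R)"
proof -
  note S = scalars_prime[OF P]
  have "ideal (J <+> PIdl a) R" using add_ideals J cgenideal_ideal a by blast
  moreover have "J \<subseteq> J <+> PIdl a"
    using subset_set_add idealD(1)[OF J] idealD(2)[OF cgenideal_ideal[OF a]] by blast
  ultimately have "lenR P J (carrier R) =
      lenR P J (J <+> PIdl a) + lenR P (J <+> PIdl a) (carrier R)"
    unfolding lenR_def
    by (intro rel_length_add[OF S])
      (use J idealD(1) oneideal in \<open>auto simp: submod_carrier_iff\<close>)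
  moreover have "lenR P {r \<in> carrier R. a \<otimes> r \<in> J} (carrier R) = lenR P J (J <+> PIdl a)"
    unfolding lenR_def image_mult_carrier[OF a, symmetric]
    by (rule rel_length_mult[OF S]) (use J a in \<open>auto simp: submod_carrier_iff oneideal\<close>)
  ultimately show ?thesis by simp
qed

lemma lenR_mono: "A \<subseteq> A' \<Longrightarrow> lenR P A' B \<le> lenR P A B"
  unfolding lenR_def by (rule rel_length_mono) auto

text \<open>An element of J outside P becomes a unit at P.\<close>

lemma lenR_eq_0:
  assumes "primeideal P R" "ideal J R" "\<not> J \<subseteq> P"
  shows "lenR P J (carrier R) = 0"
proof -
  obtain y where y: "y \<in> J" "y \<notin> P" using assms by auto
  then have "absorbs (carrier R - P) J (carrier R)"
    using idealD(5,6)[OF assms(2)] by (auto simp: absorbs_def intro!: bexI[of _ y])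
  then show ?thesis
    unfolding lenR_def using idealD(1)[OF assms(2)] oneideal
    by (subst rel_length_eq_0_iff) (auto simp: submod_carrier_iff)
qed

text \<open>R/P localised at P is the residue field. Concretely, a first strict step D contains some
  d outside P, and d itself multiplies everything into D, which rules out a second strict
  step.\<close>

lemma lenR_prime:
  assumes P: "primeideal P R"
  shows "lenR P P (carrier R) = 1"
proof (rule antisym)
  have PR: "P \<subseteq> carrier R" "ideal P R" using primeD(1)[OF P] idealD(1) by auto
  have "\<not> enat 2 \<le> lenR P P (carrier R)"
  proof
    assume "enat 2 \<le> lenR P P (carrier R)"
    then have "strict_chain (carrier R) (carrier R - P) (Suc (Suc 0)) P (carrier R)"
      unfolding lenR_def enat_le_rel_length_iff[OF PR(1)] by (simp add: numeral_2_eq_2)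
    then obtain D E where DE: "submod (carrier R) D" "\<not> absorbs (carrier R - P) P D"
       "\<not> absorbs (carrier R - P) D E" "E \<subseteq> carrier R" by auto
    then obtain d where d: "d \<in> D" "\<one> \<otimes> d \<notin> P"
      using primeD(2)[OF P] unfolding absorbs_def by blast
    then have "d \<in> carrier R - P" using submodD(5)[OF DE(1)] by auto
    moreover have "d \<otimes> e \<in> D" if "e \<in> E" for e
      using idealD(6)[of D e d] DE d that by (auto simp: submod_carrier_iff)
    ultimately show False using DE(3) unfolding absorbs_def by blast
  qed
  then show "lenR P P (carrier R) \<le> 1"
    by (cases "lenR P P (carrier R)") (auto simp: one_enat_def)
  have "\<not> absorbs (carrier R - P) P (carrier R)"
    unfolding absorbs_def by (auto intro!: bexI[of _ \<one>])
  then show "1 \<le> lenR P P (carrier R)"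
    unfolding lenR_def using rel_length_ge_1_iff[OF _ PR(1)] oneideal
    by (auto simp: submod_carrier_iff)
qed

section \<open>Adding powers of one element to an ideal\<close>

lemma set_add_cgenideal_least:
  assumes "ideal N R" "J \<subseteq> N" "x \<in> N"
  shows "J <+> PIdl x \<subseteq> N"
  using assms set_add_least[OF assms(1)[folded submod_carrier_iff]] cgenideal_minimal by blast

lemma set_add_cgenideal_upper:
  assumes "ideal J R" "x \<in> carrier R"
  shows "J \<subseteq> J <+> PIdl x" "x \<in> J <+> PIdl x" "ideal (J <+> PIdl x) R"
proof -
  show "J \<subseteq> J <+> PIdl x"
    using subset_set_add idealD(1)[OF assms(1)] idealD(2)[OF cgenideal_ideal[OF assms(2)]] by blast
  have "\<zero> \<oplus> x \<in> J <+> PIdl x"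
    using set_addI idealD(2)[OF assms(1)] cgenideal_self[OF assms(2)] by blast
  then show "x \<in> J <+> PIdl x" using assms by simp
  show "ideal (J <+> PIdl x) R" using add_ideals cgenideal_ideal assms by blast
qed

text \<open>Prepares \<open>lenR_colon\<close> for K = J + (x^(n+1)) and the multiplier x^n: the
  colon ideal contains J + (x), and the sum is J + (x^n).\<close>

lemma colon_pow_step:
  fixes n :: nat
  assumes J: "ideal J R" and x: "x \<in> carrier R"
  defines "K \<equiv> J <+> PIdl (x [^] Suc n)"
  shows "J <+> PIdl x \<subseteq> {r \<in> carrier R. x [^] n \<otimes> r \<in> K}"
    "K <+> PIdl (x [^] n) = J <+> PIdl (x [^] n)" "ideal K R"
proof -
  note K = set_add_cgenideal_upper[OF J, of "x [^] Suc n", folded K_def]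
  show "ideal K R" using K x by auto
  show "J <+> PIdl x \<subseteq> {r \<in> carrier R. x [^] n \<otimes> r \<in> K}"
  proof (rule set_add_cgenideal_least)
    show "ideal {r \<in> carrier R. x [^] n \<otimes> r \<in> K} R" using colon_ideal K x by auto
    show "J \<subseteq> {r \<in> carrier R. x [^] n \<otimes> r \<in> K}"
      using idealD(4,5)[OF J] K(1) x by auto
    show "x \<in> {r \<in> carrier R. x [^] n \<otimes> r \<in> K}" using K x by simp
  qed
  note L = set_add_cgenideal_upper[OF J, of "x [^] n"]
  have "x [^] Suc n \<in> J <+> PIdl (x [^] n)"
    using L x idealD(6) by auto
  then have "K <+> PIdl (x [^] n) \<subseteq> J <+> PIdl (x [^] n)"
    unfolding K_def using L x by (intro set_add_cgenideal_least) auto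
  moreover have "J <+> PIdl (x [^] n) \<subseteq> K <+> PIdl (x [^] n)"
    using K x by (intro set_add_mono) auto
  ultimately show "K <+> PIdl (x [^] n) = J <+> PIdl (x [^] n)" by auto
qed

lemma set_add_PIdl_one: "ideal J R \<Longrightarrow> J <+> PIdl \<one> = carrier R"
  using ideal.one_imp_carrier set_add_cgenideal_upper(2,3) by blast

lemma lenR_carrier: "primeideal P R \<Longrightarrow> lenR P (carrier R) (carrier R) = 0"
  unfolding lenR_def by (rule rel_length_refl) (auto simp: scalars_prime submod_carrier_iff oneideal)

text \<open>By \<open>colon_pow_step\<close>, passing from x^n to x^(n+1) costs at most the colength
  of J + (x).\<close>

lemma lenR_pow_le:
  assumes P: "primeideal P R" and J: "ideal J R" and x: "x \<in> carrier R"
  shows "lenR P (J <+> PIdl (x [^] n)) (carrier R) \<le> of_nat n * lenR P (J <+> PIdl x) (carrier R)"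
proof (induction n)
  case 0
  then show ?case using set_add_PIdl_one[OF J] lenR_carrier[OF P] by simp
next
  case (Suc n)
  note K = colon_pow_step[OF J x, of n]
  have "lenR P (J <+> PIdl (x [^] Suc n)) (carrier R) \<le>
     lenR P (J <+> PIdl x) (carrier R) + of_nat n * lenR P (J <+> PIdl x) (carrier R)"
    unfolding lenR_colon[OF P K(3) nat_pow_closed[OF x, of n]] K(2)
    by (intro add_mono Suc.IH lenR_mono K)
  then show ?case by (simp add: distrib_right)
qed

text \<open>For a prime J without x the power x^n is a nonzerodivisor modulo J, so the colon ideal
  is exactly J + (x) and every step costs the same. This exact linearity drives the comparison of
  ranks.\<close>

lemma lenR_pow_eq:
  assumes P: "primeideal P R" and J: "primeideal J R" and x: "x \<in> carrier R" "x \<notin> J"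
  shows "lenR P (J <+> PIdl (x [^] n)) (carrier R) = of_nat n * lenR P (J <+> PIdl x) (carrier R)"
proof (induction n)
  case 0
  then show ?case using set_add_PIdl_one[OF primeD(1)[OF J]] lenR_carrier[OF P] by simp
next
  case (Suc n)
  note K = colon_pow_step[OF primeD(1)[OF J] x(1), of n]
  note Jc = idealD[OF primeD(1)[OF J]]
  have "{r \<in> carrier R. x [^] n \<otimes> r \<in> J <+> PIdl (x [^] Suc n)} \<subseteq> J <+> PIdl x"
  proof clarify
    fix r assume r: "r \<in> carrier R" "x [^] n \<otimes> r \<in> J <+> PIdl (x [^] Suc n)"
    then obtain j s where js: "j \<in> J" "s \<in> carrier R" "x [^] n \<otimes> r = j \<oplus> x [^] Suc n \<otimes> s"
      using x by (auto simp: mem_set_add_iff mem_cgenideal_iff)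
    have "x [^] n \<otimes> (r \<ominus> x \<otimes> s) = x [^] n \<otimes> r \<ominus> x [^] Suc n \<otimes> s"
      using r js x by (simp add: a_minus_def r_distr r_minus m_assoc)
    also have "\<dots> = j"
      unfolding js(3) using js x Jc(5) by (simp add: a_minus_def a_assoc r_neg)
    finally have "x [^] n \<otimes> (r \<ominus> x \<otimes> s) \<in> J" using js by simp
    then have "r \<ominus> x \<otimes> s \<in> J"
      using primeD(3)[OF J, of "x [^] n" "r \<ominus> x \<otimes> s"] prime_pow_notin[OF J x] x r js by auto
    then have "(r \<ominus> x \<otimes> s) \<oplus> x \<otimes> s \<in> J <+> PIdl x"
      using js x by (intro set_addI) (auto simp: mem_cgenideal_iff)
    then show "r \<in> J <+> PIdl x"
      using r js x by (simp add: a_minus_def a_assoc l_neg)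
  qed
  with K(1) have "{r \<in> carrier R. x [^] n \<otimes> r \<in> J <+> PIdl (x [^] Suc n)} = J <+> PIdl x" by auto
  then show ?case
    unfolding lenR_colon[OF P K(3) nat_pow_closed[OF x(1), of n]] K(2) Suc.IH by (simp add: distrib_right)
qed

section \<open>Noetherian induction on ideals\<close>

lemma noetherian_ideal_induct:
  assumes noeth: "noetherian_ring R" and J: "ideal J R"
    and step: "\<And>J. ideal J R \<Longrightarrow> (\<And>J'. ideal J' R \<Longrightarrow> J \<subset> J' \<Longrightarrow> \<Phi> J') \<Longrightarrow> \<Phi> J"
  shows "\<Phi> J"
proof (rule ccontr)
  assume "\<not> \<Phi> J"
  define Bad where "Bad = {J. ideal J R \<and> \<not> \<Phi> J}"
  \<comment> \<open>A maximal counterexample exists: a nonempty chain of them contains its own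
    union, as R is noetherian.\<close>
  have "\<exists>M\<in>Bad. \<forall>N\<in>Bad. M \<subseteq> N \<longrightarrow> N = M"
  proof (rule subset_Zorn)
    fix C assume C: "subset.chain Bad C"
    show "\<exists>U\<in>Bad. \<forall>N\<in>C. N \<subseteq> U"
    proof (cases "C = {}")
      case True
      then show ?thesis using J \<open>\<not> \<Phi> J\<close> by (auto simp: Bad_def)
    next
      case False
      have "\<Union>C \<in> C"
        using noetherian_ring.ideal_chain_is_trivial[OF noeth False] C
        by (auto simp: Bad_def subset_chain_def)
      then show ?thesis using C by (auto simp: subset_chain_def intro!: bexI[of _ "\<Union>C"])
    qed
  qed
  then obtain M where M: "ideal M R" "\<not> \<Phi> M" "\<And>N. ideal N R \<Longrightarrow> \<not> \<Phi> N \<Longrightarrow> M \<subseteq> N \<Longrightarrow> N = M"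
    by (auto simp: Bad_def)
  then show False using step[OF M(1)] by blast
qed

text \<open>Replaces prime filtrations: \<open>0 \<rightarrow> R/(J : a) \<rightarrow> R/J \<rightarrow> R/(J + aR) \<rightarrow> 0\<close>.\<close>

lemma ideal_prime_induct:
  assumes noeth: "noetherian_ring R" and J: "ideal J R"
    and top: "\<Phi> (carrier R)" and prime: "\<And>J. primeideal J R \<Longrightarrow> \<Phi> J"
    and step: "\<And>J a. ideal J R \<Longrightarrow> a \<in> carrier R \<Longrightarrow>
       \<Phi> (J <+> PIdl a) \<Longrightarrow> \<Phi> {r \<in> carrier R. a \<otimes> r \<in> J} \<Longrightarrow> \<Phi> J"
  shows "\<Phi> J"
proof (rule noetherian_ideal_induct[OF noeth J])
  fix J assume J: "ideal J R" and IH: "\<And>J'. ideal J' R \<Longrightarrow> J \<subset> J' \<Longrightarrow> \<Phi> J'"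
  show "\<Phi> J"
  proof (cases "primeideal J R \<or> J = carrier R")
    case True
    then show ?thesis using top prime by blast
  next
    case False
    then obtain a b where ab: "a \<in> carrier R" "b \<in> carrier R" "a \<otimes> b \<in> J" "a \<notin> J" "b \<notin> J"
      using J primeidealI[OF J is_cring] by blast
    have "J \<subset> J <+> PIdl a" "ideal (J <+> PIdl a) R"
      using set_add_cgenideal_upper[OF J ab(1)] ab(4) by auto
    moreover have "J \<subset> {r \<in> carrier R. a \<otimes> r \<in> J}"
      using ab idealD(4,5)[OF J] by blast
    ultimately show ?thesis
      using step[OF J ab(1)] IH colon_ideal[OF J ab(1)] by blast
  qed
qed

text \<open>Equivalently, (R/J)_P has Krull dimension at least n.\<close>

definition prime_chain :: "'a set \<Rightarrow> nat \<Rightarrow> 'a set \<Rightarrow> bool" where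
  "prime_chain P n J \<longleftrightarrow> (\<exists>C::nat \<Rightarrow> 'a set. (\<forall>i\<le>n. primeideal (C i) R \<and> J \<subseteq> C i \<and> C i \<subseteq> P) \<and>
     (\<forall>i<n. C i \<subset> C (Suc i)))"

lemma prime_chain_antimono: "prime_chain P n J' \<Longrightarrow> J \<subseteq> J' \<Longrightarrow> prime_chain P n J"
  unfolding prime_chain_def by (meson order_trans)

lemma prime_chain_Suc:
  assumes "primeideal J R" "J \<subset> J'" "J' \<subseteq> P" "prime_chain P n J'"
  shows "prime_chain P (Suc n) J"
proof -
  from assms(4) obtain C where C: "\<forall>i\<le>n. primeideal (C i) R \<and> J' \<subseteq> C i \<and> C i \<subseteq> P"
      "\<forall>i<n. C i \<subset> C (Suc i)"
    unfolding prime_chain_def by blast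
  define D where "D = (\<lambda>i. case i of 0 \<Rightarrow> J | Suc i \<Rightarrow> C i)"
  have "primeideal (D i) R \<and> J \<subseteq> D i \<and> D i \<subseteq> P" if "i \<le> Suc n" for i
  proof (cases i)
    case (Suc j)
    then have "primeideal (C j) R" "J' \<subseteq> C j" "C j \<subseteq> P" using that C(1) by auto
    then show ?thesis using assms(2) Suc by (auto simp: D_def)
  qed (use assms in \<open>auto simp: D_def\<close>)
  moreover have "J' \<subseteq> C 0" using C(1) by simp
  then have "D i \<subset> D (Suc i)" if "i < Suc n" for i
    using that assms(2) C(2) by (cases i) (auto simp: D_def)
  ultimately show ?thesis unfolding prime_chain_def by blast
qed

lemma ideal_add_upper:
  assumes "ideal J R" "ideal W R"
  shows "J \<subseteq> J <+> W" "W \<subseteq> J <+> W" "ideal (J <+> W) R"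
proof -
  show "J \<subseteq> J <+> W" using subset_set_add idealD(1)[OF assms(1)] idealD(2)[OF assms(2)] by blast
  show "W \<subseteq> J <+> W"
    using set_addI[OF idealD(2)[OF assms(1)], of _ W] idealD(5)[OF assms(2)] by fastforce
  show "ideal (J <+> W) R" using add_ideals assms by blast
qed

lemma ideal_add_least: "ideal N R \<Longrightarrow> J \<subseteq> N \<Longrightarrow> W \<subseteq> N \<Longrightarrow> J <+> W \<subseteq> N"
  unfolding submod_carrier_iff[symmetric] by (rule set_add_least)

text \<open>A Hilbert-Samuel type bound: if (R/J)_P has dimension below e, the colengths of J + W
  are O(n^(e-1)), uniformly in the ideals W that contain all n-th powers from P. The factor n on the
  left avoids the exponent e - 1 at e = 0. The proof is an induction on e with a prime filtration
  inside: for a prime J properly below P, some x in P - J cuts the dimension, and x^n already lies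
  in W.\<close>

lemma power_length_bound:
  assumes noeth: "noetherian_ring R" and P: "primeideal P R"
    and J: "ideal J R" "\<not> prime_chain P e J"
  shows "\<exists>C::nat. \<forall>n\<ge>1. \<forall>W. ideal W R \<and> (\<forall>x\<in>P. x [^] n \<in> W) \<longrightarrow>
    of_nat n * lenR P (J <+> W) (carrier R) \<le> of_nat (C * n ^ e)"
proof -
  define \<Phi> where "\<Phi> e J \<longleftrightarrow> (\<exists>C::nat. \<forall>n\<ge>1. \<forall>W. ideal W R \<and> (\<forall>x\<in>P. x [^] n \<in> W) \<longrightarrow>
    of_nat n * lenR P (J <+> W) (carrier R) \<le> of_nat (C * n ^ e))" for e J
  have zero: "\<Phi> e J" if "ideal J R" "\<not> J \<subseteq> P" for e J
    unfolding \<Phi>_def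
  proof (intro exI[of _ 0] allI impI)
    fix n :: nat and W assume W: "ideal W R \<and> (\<forall>x\<in>P. x [^] n \<in> W)"
    then have "lenR P (J <+> W) (carrier R) = 0"
      using lenR_eq_0[OF P] ideal_add_upper[OF that(1), of W] that(2) by blast
    then show "of_nat n * lenR P (J <+> W) (carrier R) \<le> of_nat (0 * n ^ e)" by simp
  qed
  have "\<Phi> e J" using J
  proof (induction e arbitrary: J rule: less_induct)
    case (less e J)
    have "\<not> prime_chain P e J \<longrightarrow> \<Phi> e J"
    proof (rule ideal_prime_induct[OF noeth less.prems(1)])
      show "\<not> prime_chain P e (carrier R) \<longrightarrow> \<Phi> e (carrier R)"
        using zero[OF oneideal] primeD(2)[OF P] by blast
    next
      fix J assume J: "primeideal J R"
      note Ji = primeD(1)[OF J]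
      show "\<not> prime_chain P e J \<longrightarrow> \<Phi> e J"
      proof
        assume nc: "\<not> prime_chain P e J"
        show "\<Phi> e J"
        proof (cases "J \<subseteq> P")
          case False
          then show ?thesis using zero Ji by blast
        next
          case JP: True
          \<comment> \<open>J itself is a chain of length 0 below P, so e is positive and the
            induction can pass to e - 1.\<close>
          have "prime_chain P 0 J" unfolding prime_chain_def using J JP by auto
          then obtain e' where e': "e = Suc e'" using nc by (cases e) auto
          show ?thesis
          proof (cases "J = P")
            case True
            have "of_nat n * lenR P (J <+> W) (carrier R) \<le> of_nat (1 * n ^ e)"
              if "n \<ge> 1" "ideal W R" for n W
            proof -
              have "lenR P (J <+> W) (carrier R) \<le> lenR P P (carrier R)"
                using ideal_add_upper[OF Ji that(2)] True by (intro lenR_mono) auto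
              then have "of_nat n * lenR P (J <+> W) (carrier R) \<le> of_nat n * 1"
                unfolding lenR_prime[OF P] by (rule mult_left_mono) simp
              also have "\<dots> \<le> of_nat (1 * n ^ e)"
                using that(1) e' by (simp add: of_nat_eq_enat del: of_nat_power)
              finally show ?thesis .
            qed
            then show ?thesis unfolding \<Phi>_def by blast
          next
            case False
            then obtain x where x: "x \<in> P" "x \<notin> J" "x \<in> carrier R"
              using JP idealD(5)[OF primeD(1)[OF P]] by blast
            define J1 where "J1 = J <+> PIdl x"
            note J1 = set_add_cgenideal_upper[OF Ji x(3), folded J1_def]
            have J1P: "J \<subset> J1" "J1 \<subseteq> P"
              using J1 x set_add_cgenideal_least[OF primeD(1)[OF P] JP x(1)] by (auto simp: J1_def)
            have "\<Phi> e' J1"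
              using less.IH[of e' J1] J1(3) prime_chain_Suc[OF J J1P] nc e' by blast
            then obtain C where C: "\<And>n W. n \<ge> 1 \<Longrightarrow> ideal W R \<Longrightarrow> (\<forall>x\<in>P. x [^] n \<in> W) \<Longrightarrow>
                of_nat n * lenR P (J1 <+> W) (carrier R) \<le> of_nat (C * n ^ e')"
              unfolding \<Phi>_def by blast
            have "of_nat n * lenR P (J <+> W) (carrier R) \<le> of_nat (C * n ^ e)"
              if n: "n \<ge> 1" and W: "ideal W R" "\<forall>x\<in>P. x [^] n \<in> W" for n W
            proof -
              define K where "K = J <+> W"
              note K = ideal_add_upper[OF Ji W(1), folded K_def]
              note Kx = set_add_cgenideal_upper[OF K(3) x(3)]
              \<comment> \<open>As x^n lies in W, adding it to K changes nothing; the comparison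
                with the first power of x then costs a factor n.\<close>
              have "K <+> PIdl (x [^] n) \<subseteq> K"
                using K W(2) x(1) by (intro set_add_cgenideal_least) auto
              then have "lenR P K (carrier R) \<le> lenR P (K <+> PIdl (x [^] n)) (carrier R)"
                by (rule lenR_mono)
              also have "\<dots> \<le> of_nat n * lenR P (K <+> PIdl x) (carrier R)"
                by (rule lenR_pow_le[OF P K(3) x(3)])
              also have "\<dots> \<le> of_nat n * lenR P (J1 <+> W) (carrier R)"
                unfolding J1_def using Kx K
                by (intro mult_left_mono lenR_mono ideal_add_least set_add_cgenideal_least) auto
              also have "\<dots> \<le> of_nat (C * n ^ e')"
                by (rule C[OF n W])
              finally have "of_nat n * lenR P K (carrier R) \<le> of_nat n * of_nat (C * n ^ e')"
                by (rule mult_left_mono) simp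
              then show ?thesis using e' by (simp add: K_def mult_ac)
            qed
            then show ?thesis unfolding \<Phi>_def by blast
          qed
        qed
      qed
    next
      fix J a
      assume J: "ideal J R" and a: "a \<in> carrier R"
        and IH: "\<not> prime_chain P e (J <+> PIdl a) \<longrightarrow> \<Phi> e (J <+> PIdl a)"
          "\<not> prime_chain P e {r \<in> carrier R. a \<otimes> r \<in> J} \<longrightarrow> \<Phi> e {r \<in> carrier R. a \<otimes> r \<in> J}"
      define Ja where "Ja = J <+> PIdl a"
      define Jc where "Jc = {r \<in> carrier R. a \<otimes> r \<in> J}"
      note Ja = set_add_cgenideal_upper[OF J a, folded Ja_def]
      have Jc: "J \<subseteq> Jc" "ideal Jc R"
        using idealD(4,5)[OF J] a colon_ideal[OF J a] by (auto simp: Jc_def)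
      show "\<not> prime_chain P e J \<longrightarrow> \<Phi> e J"
      proof
        assume nc: "\<not> prime_chain P e J"
        have \<Phi>: "\<Phi> e Ja" "\<Phi> e Jc"
          using IH nc prime_chain_antimono[of P e _ J] Ja(1) Jc(1) unfolding Ja_def Jc_def by blast+
        obtain C1 where
          C1: "\<And>n W. n \<ge> 1 \<Longrightarrow> ideal W R \<Longrightarrow> (\<forall>x\<in>P. x [^] n \<in> W) \<Longrightarrow>
                of_nat n * lenR P (Ja <+> W) (carrier R) \<le> of_nat (C1 * n ^ e)"
          using \<Phi>(1) unfolding \<Phi>_def by blast
        obtain C2 where
          C2: "\<And>n W. n \<ge> 1 \<Longrightarrow> ideal W R \<Longrightarrow> (\<forall>x\<in>P. x [^] n \<in> W) \<Longrightarrow>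
                of_nat n * lenR P (Jc <+> W) (carrier R) \<le> of_nat (C2 * n ^ e)"
          using \<Phi>(2) unfolding \<Phi>_def by blast
        have "of_nat n * lenR P (J <+> W) (carrier R) \<le> of_nat ((C2 + C1) * n ^ e)"
          if n: "n \<ge> 1" and W: "ideal W R" "\<forall>x\<in>P. x [^] n \<in> W" for n W
        proof -
          define K where "K = J <+> W"
          note K = ideal_add_upper[OF J W(1), folded K_def]
          note Ka = set_add_cgenideal_upper[OF K(3) a]
          \<comment> \<open>(J : a) + W lies in (J + W) : a, so the exact sequence for J + W is
            controlled by the bounds for the two larger ideals.\<close>
          have "Jc <+> W \<subseteq> {r \<in> carrier R. a \<otimes> r \<in> K}"
          proof (rule ideal_add_least)
            show "ideal {r \<in> carrier R. a \<otimes> r \<in> K} R" by (rule colon_ideal[OF K(3) a])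
            show "Jc \<subseteq> {r \<in> carrier R. a \<otimes> r \<in> K}" using K(1) by (auto simp: Jc_def)
            show "W \<subseteq> {r \<in> carrier R. a \<otimes> r \<in> K}"
              using K(2) idealD(4)[OF K(3) a] idealD(5)[OF W(1)] by auto
          qed
          moreover have "Ja <+> W \<subseteq> K <+> PIdl a"
            unfolding Ja_def using Ka K by (intro ideal_add_least set_add_cgenideal_least) auto
          ultimately have "lenR P K (carrier R) \<le>
              lenR P (Jc <+> W) (carrier R) + lenR P (Ja <+> W) (carrier R)"
            unfolding lenR_colon[OF P K(3) a] by (intro add_mono lenR_mono)
          then have "of_nat n * lenR P K (carrier R) \<le>
              of_nat n * (lenR P (Jc <+> W) (carrier R) + lenR P (Ja <+> W) (carrier R))"
            by (rule mult_left_mono) simp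
          also have "\<dots> \<le> of_nat (C2 * n ^ e) + of_nat (C1 * n ^ e)"
            unfolding distrib_left by (intro add_mono C1 C2 n W)
          finally show ?thesis by (simp add: K_def distrib_right)
        qed
        then show "\<Phi> e J" unfolding \<Phi>_def by blast
      qed
    qed
    then show ?case using less.prems(2) by blast
  qed
  then show ?thesis unfolding \<Phi>_def .
qed

text \<open>\<open>adj\<close> leaves P as the only prime strictly above Q inside P, so each factor
  of a prime filtration of R/J vanishes at P or contributes length 1.\<close>

lemma lenR_finite:
  assumes noeth: "noetherian_ring R" and P: "primeideal P R"
    and adj: "\<And>P'. primeideal P' R \<Longrightarrow> Q \<subset> P' \<Longrightarrow> P' \<subseteq> P \<Longrightarrow> P' = P"
    and J: "ideal J R" "Q \<subset> J"
  shows "lenR P J (carrier R) \<noteq> \<infinity>"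
proof -
  have "Q \<subset> J \<longrightarrow> lenR P J (carrier R) \<noteq> \<infinity>"
  proof (rule ideal_prime_induct[OF noeth J(1)])
    show "Q \<subset> carrier R \<longrightarrow> lenR P (carrier R) (carrier R) \<noteq> \<infinity>"
      using lenR_carrier[OF P] by simp
  next
    fix J assume J: "primeideal J R"
    show "Q \<subset> J \<longrightarrow> lenR P J (carrier R) \<noteq> \<infinity>"
    proof (cases "J \<subseteq> P")
      case False
      then show ?thesis using lenR_eq_0[OF P primeD(1)[OF J]] by simp
    next
      case True
      then show ?thesis using adj[OF J] lenR_prime[OF P] by (auto simp: one_enat_def)
    qed
  next
    fix J a assume J: "ideal J R" and a: "a \<in> carrier R"
      and IH: "Q \<subset> J <+> PIdl a \<longrightarrow> lenR P (J <+> PIdl a) (carrier R) \<noteq> \<infinity>"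
        "Q \<subset> {r \<in> carrier R. a \<otimes> r \<in> J} \<longrightarrow> lenR P {r \<in> carrier R. a \<otimes> r \<in> J} (carrier R) \<noteq> \<infinity>"
    have "J \<subseteq> {r \<in> carrier R. a \<otimes> r \<in> J}"
      using idealD(4,5)[OF J] a by auto
    then show "Q \<subset> J \<longrightarrow> lenR P J (carrier R) \<noteq> \<infinity>"
      unfolding lenR_colon[OF P J a] using IH set_add_cgenideal_upper(1)[OF J a]
      by (auto simp: plus_eq_infty_iff_enat)
  qed
  then show ?thesis using J by blast
qed

end

subsection \<open>Frobenius and spans over the subring of p-th powers\<close>

lemma (in cring) add_pow_binomial:
  assumes x: "x \<in> carrier R" and y: "y \<in> carrier R"
  shows "(x \<oplus> y) [^] n = (\<Oplus>k\<in>{..n::nat}. [(n choose k)] \<cdot> (x [^] k \<otimes> y [^] (n - k)))"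
proof (induction n)
  case 0
  then show ?case using x y by (simp add: add.nat_pow_eone)
next
  case (Suc n)
  define t where "t k = x [^] Suc k \<otimes> y [^] (n - k)" for k
  have t: "t k \<in> carrier R" for k using x y by (simp add: t_def)
  let ?S = "\<Oplus>k\<in>{..n}. [(n choose k)] \<cdot> (x [^] k \<otimes> y [^] (n - k))"
  have "x \<otimes> ?S = (\<Oplus>k\<in>{..n}. [(n choose k)] \<cdot> t k)"
    using x y by (subst finsum_rdistr)
      (auto simp: t_def add_pow_rdistr m_ac intro!: finsum_cong')
  moreover have "y \<otimes> ?S = y [^] Suc n \<oplus> (\<Oplus>k\<in>{..n}. [(n choose Suc k)] \<cdot> t k)"
  proof -
    have "y \<otimes> ?S = (\<Oplus>k\<in>{..n}. [(n choose k)] \<cdot> (x [^] k \<otimes> y [^] (Suc n - k)))"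
      using x y by (subst finsum_rdistr)
        (auto simp: Suc_diff_le add_pow_rdistr m_ac intro!: finsum_cong')
    also have "\<dots> = (\<Oplus>k\<in>{..Suc n}. [(n choose k)] \<cdot> (x [^] k \<otimes> y [^] (Suc n - k)))"
      using x y by (subst finsum_Suc) (auto simp: binomial_eq_0)
    also have "\<dots> = (\<Oplus>k\<in>{..n}. [(n choose Suc k)] \<cdot> t k) \<oplus> y [^] Suc n"
      using x y by (subst finsum_Suc2) (auto simp: t_def add.nat_pow_eone)
    finally show ?thesis
      using y t by (simp add: a_comm)
  qed
  moreover have "?S \<in> carrier R" using x y by auto
  ultimately have "(x \<oplus> y) [^] Suc n = (\<Oplus>k\<in>{..n}. [(n choose k)] \<cdot> t k) \<oplus>
      (y [^] Suc n \<oplus> (\<Oplus>k\<in>{..n}. [(n choose Suc k)] \<cdot> t k))"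
    using x y Suc.IH by (simp add: m_comm[of _ "x \<oplus> y"] l_distr)
  also have "\<dots> = ((\<Oplus>k\<in>{..n}. [(n choose k)] \<cdot> t k) \<oplus> (\<Oplus>k\<in>{..n}. [(n choose Suc k)] \<cdot> t k))
      \<oplus> y [^] Suc n"
    using y t by (simp add: a_ac)
  also have "\<dots> = (\<Oplus>k\<in>{..n}. [(Suc n choose Suc k)] \<cdot> t k) \<oplus> y [^] Suc n"
    using t by (simp add: finsum_addf[symmetric] add.nat_pow_mult)
  also have "\<dots> = (\<Oplus>k\<in>{..Suc n}. [(Suc n choose k)] \<cdot> (x [^] k \<otimes> y [^] (Suc n - k)))"
    using x y by (subst finsum_Suc2) (auto simp: t_def add.nat_pow_eone simp del: binomial_Suc_Suc)
  finally show ?case .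
qed

locale prime_char_ring = cring +
  fixes p :: nat
  assumes prime_p: "Factorial_Ring.prime p" and char_p: "has_characteristic R p"
begin

lemma add_pow_eq_zero:
  assumes "p dvd m" "x \<in> carrier R"
  shows "[m] \<cdot> x = \<zero>"
proof -
  have "[m] \<cdot> \<one> = \<zero>" using char_p assms by (auto simp: has_characteristic_def)
  then have "([m] \<cdot> \<one>) \<otimes> x = \<zero>" using assms by simp
  then show ?thesis using assms by (simp add: add_pow_ldistr)
qed

lemma frob_zero: "\<zero> [^] p = \<zero>"
  using prime_p prime_gt_0_nat by (simp add: nat_pow_zero)

lemma frob_add:
  assumes "x \<in> carrier R" "y \<in> carrier R"
  shows "(x \<oplus> y) [^] p = x [^] p \<oplus> y [^] p"
proof -
  \<comment> \<open>All inner binomial coefficients are divisible by p; writing p = m + 2 isolates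
    the two outer terms.\<close>
  obtain m where m: "p = Suc (Suc m)"
    using prime_p prime_ge_2_nat by (metis add_2_eq_Suc le_Suc_ex)
  have z: "[(p choose Suc k)] \<cdot> (x [^] Suc k \<otimes> y [^] (p - Suc k)) = \<zero>" if "k \<le> m" for k
    using assms that m prime_p by (intro add_pow_eq_zero dvd_choose_prime) auto
  have "(x \<oplus> y) [^] p = (\<Oplus>k\<in>{..Suc (Suc m)}. [(p choose k)] \<cdot> (x [^] k \<otimes> y [^] (p - k)))"
    using add_pow_binomial[OF assms, of p] m by simp
  also have "\<dots> = x [^] p \<oplus> (\<Oplus>k\<in>{..Suc m}. [(p choose k)] \<cdot> (x [^] k \<otimes> y [^] (p - k)))"
    using assms by (subst finsum_Suc) (auto simp: m[symmetric] add.nat_pow_eone)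
  also have "(\<Oplus>k\<in>{..Suc m}. [(p choose k)] \<cdot> (x [^] k \<otimes> y [^] (p - k))) =
      (\<Oplus>k\<in>{..m}. [(p choose Suc k)] \<cdot> (x [^] Suc k \<otimes> y [^] (p - Suc k))) \<oplus> y [^] p"
    using assms by (subst finsum_Suc2) (auto simp: add.nat_pow_eone)
  also have "(\<Oplus>k\<in>{..m}. [(p choose Suc k)] \<cdot> (x [^] Suc k \<otimes> y [^] (p - Suc k))) = \<zero>"
    using z finsum_zero[of "{..m}"] by (subst finsum_cong'[where g = "\<lambda>_. \<zero>"]) auto
  finally show ?thesis using assms by simp
qed

lemma frob_mult: "x \<in> carrier R \<Longrightarrow> y \<in> carrier R \<Longrightarrow> (x \<otimes> y) [^] p = x [^] p \<otimes> y [^] p"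
  by (rule nat_pow_distrib)

abbreviation frob :: "'a \<Rightarrow> 'a" where
  "frob x \<equiv> x [^] p"

lemma frob_uminus:
  assumes "x \<in> carrier R"
  shows "frob (\<ominus> x) = \<ominus> frob x"
proof -
  have "frob (\<ominus> x) \<oplus> frob x = \<zero>"
    using assms by (simp add: frob_add[symmetric] l_neg frob_zero)
  then show ?thesis using assms by (simp add: minus_equality)
qed

lemma frob_minus:
  assumes "x \<in> carrier R" "y \<in> carrier R"
  shows "frob (x \<ominus> y) = frob x \<ominus> frob y"
  using assms by (simp add: a_minus_def frob_add frob_uminus)

lemma frob_factor: "x \<in> carrier R \<Longrightarrow> \<exists>r\<in>carrier R. frob x = r \<otimes> x"
  using prime_p prime_gt_0_nat by (cases p) auto

lemma frob_in_ideal: "ideal J R \<Longrightarrow> x \<in> J \<Longrightarrow> frob x \<in> J"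
  using frob_factor[of x] idealD(4,5)[of J] by auto

section \<open>Localised lengths over the ring of p-th powers\<close>

lemma scalars_frob:
  assumes P: "primeideal P R"
  shows "scalars (frob ` carrier R) (frob ` (carrier R - P))"
  unfolding scalars_def
proof (intro conjI ballI)
  show "\<ominus> \<one> \<in> frob ` carrier R"
    using frob_uminus[of \<one>] by (auto intro!: image_eqI[of _ _ "\<ominus> \<one>"])
  show "\<one> \<in> frob ` (carrier R - P)"
    using primeD(2)[OF P] by (auto intro!: image_eqI[of _ _ "\<one>"])
  fix y y' assume "y \<in> frob ` (carrier R - P)" "y' \<in> frob ` (carrier R - P)"
  then obtain z z' where z: "z \<in> carrier R" "z' \<in> carrier R" "z \<notin> P" "z' \<notin> P" "y = frob z" "y' = frob z'"
    by auto
  then have "y \<otimes> y' = frob (z \<otimes> z')" "z \<otimes> z' \<in> carrier R - P"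
    using frob_mult primeD(3)[OF P] by auto
  then show "y \<otimes> y' \<in> frob ` (carrier R - P)" by blast
qed auto

text \<open>For ideals A \<subseteq> B this is the length of F_*(B/A) localised at P, over R_P: an
  element y acts on F_* through y^p.\<close>

definition lenS :: "'a set \<Rightarrow> 'a set \<Rightarrow> 'a set \<Rightarrow> enat" where
  "lenS P = rel_length (frob ` carrier R) (frob ` (carrier R - P))"

lemma submod_frob_ideal: "ideal J R \<Longrightarrow> submod (frob ` carrier R) J"
  using idealD(1-4)[of J] by (intro submodI) auto

lemma lenS_mono: "A \<subseteq> A' \<Longrightarrow> B' \<subseteq> B \<Longrightarrow> lenS P A' B' \<le> lenS P A B"
  unfolding lenS_def by (rule rel_length_mono)

lemma lenS_add:
  assumes "primeideal P R" "submod (frob ` carrier R) A" "submod (frob ` carrier R) N"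
    "submod (frob ` carrier R) C" "A \<subseteq> N" "N \<subseteq> C"
  shows "lenS P A C = lenS P A N + lenS P N C"
  unfolding lenS_def by (rule rel_length_add[OF scalars_frob[OF assms(1)] assms(2-)])

lemma lenR_add:
  assumes "primeideal P R" "ideal A R" "ideal N R" "ideal C R" "A \<subseteq> N" "N \<subseteq> C"
  shows "lenR P A C = lenR P A N + lenR P N C"
  unfolding lenR_def
  by (rule rel_length_add[OF scalars_prime[OF assms(1)] assms(2-4)[folded submod_carrier_iff] assms(5,6)])

text \<open>A multiplier y that moves b into the ideal A may be replaced by y^p.\<close>

lemma lenS_eq_0:
  assumes "ideal A R" "ideal B R" "A \<subseteq> B" "lenR P A B = 0"
  shows "lenS P A B = 0"
proof -
  have "absorbs (carrier R - P) A B"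
    using assms rel_length_eq_0_iff[OF _ assms(3)] by (auto simp: lenR_def submod_carrier_iff)
  then have "absorbs (frob ` (carrier R - P)) A B"
    unfolding absorbs_def
  proof (intro ballI)
    fix b assume "\<forall>b\<in>B. \<exists>y\<in>carrier R - P. y \<otimes> b \<in> A" "b \<in> B"
    then obtain y where y: "y \<in> carrier R - P" "y \<otimes> b \<in> A" by blast
    then obtain r where "r \<in> carrier R" "frob y = r \<otimes> y" using frob_factor by blast
    then have "frob y \<otimes> b \<in> A"
      using y idealD(4)[OF assms(1)] idealD(5)[OF assms(2) \<open>b \<in> B\<close>] by (simp add: m_assoc)
    then show "\<exists>y\<in>frob ` (carrier R - P). y \<otimes> b \<in> A" using y by blast
  qed
  then show ?thesis
    unfolding lenS_def using rel_length_eq_0_iff[OF submod_frob_ideal[OF assms(2)] assms(3)] by blast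
qed

lemma lenS_cyclic:
  assumes P: "primeideal P R" and A: "ideal A R" and x: "x \<in> carrier R"
  shows "lenS P A (A <+> PIdl x) = lenS P {r \<in> carrier R. x \<otimes> r \<in> A} (carrier R)"
    "lenR P A (A <+> PIdl x) = lenR P {r \<in> carrier R. x \<otimes> r \<in> A} (carrier R)"
  unfolding lenS_def lenR_def image_mult_carrier[OF x, symmetric]
  using submod_frob_ideal[OF oneideal] submod_frob_ideal[OF A] A oneideal scalars_frob[OF P]
    scalars_prime[OF P] x
  by (auto intro!: rel_length_mult[symmetric] simp: submod_carrier_iff)

text \<open>F_* is exact and turns the residue field at P into a module of length r, so lengths get
  multiplied by r. The induction peels off one simple factor at a time and realises it as R/P up to
  localisation.\<close>

lemma lenS_eq_mult_lenR:
  assumes P: "primeideal P R" and r: "lenS P P (carrier R) = of_nat r" and B: "ideal B R"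
  shows "ideal A R \<Longrightarrow> A \<subseteq> B \<Longrightarrow> lenR P A B = enat n \<Longrightarrow> lenS P A B = of_nat r * of_nat n"
proof (induction n arbitrary: A)
  case 0
  then show ?case using lenS_eq_0[OF _ B] by (simp add: enat_0)
next
  case (Suc n)
  note A = Suc.prems(1,2)
  have "strict_chain (carrier R) (carrier R - P) (Suc n) A B"
    using enat_le_rel_length_iff[OF A(2)] Suc.prems(3) unfolding lenR_def by (metis order_refl)
  then obtain D where D: "ideal D R" "A \<subseteq> D" "D \<subseteq> B" "\<not> absorbs (carrier R - P) A D"
      "strict_chain (carrier R) (carrier R - P) n D B"
    by (auto simp: submod_carrier_iff)
  have "1 \<le> lenR P A D"
    unfolding lenR_def using rel_length_ge_1_iff D by (auto simp: submod_carrier_iff)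
  moreover have "enat n \<le> lenR P D B"
    unfolding lenR_def using enat_le_rel_length_iff D by auto
  moreover have "lenR P A D + lenR P D B = enat (Suc n)"
    using lenR_add[OF P A(1) D(1) B D(2,3)] Suc.prems(3) by simp
  ultimately have AD: "lenR P A D = 1" and DB: "lenR P D B = enat n"
    by (cases "lenR P A D"; cases "lenR P D B"; simp add: one_enat_def)+
  \<comment> \<open>After localisation x generates D modulo A: the cyclic part C already has length
    1 over A, so nothing is left of D/C.\<close>
  obtain x where x: "x \<in> D" "\<And>y. y \<in> carrier R - P \<Longrightarrow> y \<otimes> x \<notin> A"
    using D(4) by (auto simp: absorbs_def)
  have xc: "x \<in> carrier R" using x idealD(5)[OF D(1)] by blast
  define C where "C = A <+> PIdl x"
  note C = set_add_cgenideal_upper[OF A(1) xc, folded C_def]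
  have CD: "C \<subseteq> D" unfolding C_def using D x by (intro set_add_cgenideal_least) auto
  have "\<not> absorbs (carrier R - P) A C" using x C(2) unfolding absorbs_def by blast
  then have "1 \<le> lenR P A C"
    unfolding lenR_def using rel_length_ge_1_iff C by (auto simp: submod_carrier_iff)
  moreover have "lenR P A C + lenR P C D = 1"
    using lenR_add[OF P A(1) C(3) D(1) C(1) CD] AD by simp
  ultimately have AC: "lenR P A C = 1" and CD0: "lenR P C D = 0"
    by (cases "lenR P A C"; cases "lenR P C D"; simp add: one_enat_def zero_enat_def)+
  define K where "K = {r \<in> carrier R. x \<otimes> r \<in> A}"
  have K: "ideal K R" unfolding K_def by (rule colon_ideal[OF A(1) xc])
  \<comment> \<open>No multiplier outside P moves x into A, so (A : x) lies in P; both have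
    localised colength 1, hence they agree after localisation.\<close>
  have KP: "K \<subseteq> P" using x(2) xc by (auto simp: K_def m_comm) metis
  note Pi = primeD(1)[OF P]
  have "lenR P K P + 1 = 1"
    using lenR_add[OF P K Pi oneideal KP idealD(1)[OF Pi]] lenR_prime[OF P] AC
      lenS_cyclic(2)[OF P A(1) xc] by (simp add: C_def K_def)
  then have "lenR P K P = 0"
    by (cases "lenR P K P") (auto simp: one_enat_def zero_enat_def)
  then have "lenS P K P = 0" by (rule lenS_eq_0[OF K Pi KP])
  then have "lenS P K (carrier R) = of_nat r"
    using lenS_add[OF P submod_frob_ideal submod_frob_ideal submod_frob_ideal,
        OF K Pi oneideal KP idealD(1)[OF Pi]] r by simp
  then have "lenS P A C = of_nat r"
    using lenS_cyclic(1)[OF P A(1) xc] by (simp add: C_def K_def)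
  moreover have "lenS P C D = 0" by (rule lenS_eq_0[OF C(3) D(1) CD CD0])
  moreover have "lenS P D B = of_nat r * of_nat n" by (rule Suc.IH[OF D(1,3) DB])
  moreover have "lenS P A B = lenS P A D + lenS P D B"
    by (rule lenS_add[OF P submod_frob_ideal submod_frob_ideal submod_frob_ideal, OF A(1) D(1) B D(2,3)])
  moreover have "lenS P A D = lenS P A C + lenS P C D"
    by (rule lenS_add[OF P submod_frob_ideal submod_frob_ideal submod_frob_ideal, OF A(1) C(3) D(1) C(1) CD])
  ultimately show ?case by (simp add: distrib_left)
qed

text \<open>
  \<open>frob_span Q J [f\<^sub>1, \<dots>, f\<^sub>r]\<close> is the set \<open>Q + {a\<^sub>1\<^sup>p f\<^sub>1 + \<dots> + a\<^sub>r\<^sup>p f\<^sub>r | a\<^sub>i \<in> J}\<close>, and \<open>frob_indep\<close> is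
  linear independence of the \<open>f\<^sub>i\<close> in \<open>F\<^sub>*(R/Q)\<close> over \<open>R/Q\<close>.
\<close>

primrec frob_span :: "'a set \<Rightarrow> 'a set \<Rightarrow> 'a list \<Rightarrow> 'a set" where
  "frob_span Q J [] = Q"
| "frob_span Q J (f # fs) = (\<lambda>a. frob a \<otimes> f) ` J <+> frob_span Q J fs"

primrec frob_indep :: "'a set \<Rightarrow> 'a list \<Rightarrow> bool" where
  "frob_indep Q [] \<longleftrightarrow> True"
| "frob_indep Q (f # fs) \<longleftrightarrow> frob_indep Q fs \<and>
     (\<forall>a\<in>carrier R. frob a \<otimes> f \<in> frob_span Q (carrier R) fs \<longrightarrow> a \<in> Q)"

section \<open>Sets spanned with p-th power coefficients\<close>

lemma frob_carrier_subset: "frob ` carrier R \<subseteq> carrier R"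
  by auto

lemma submod_frob_image:
  assumes J: "ideal J R" and f: "f \<in> carrier R"
  shows "submod (frob ` carrier R) ((\<lambda>a. frob a \<otimes> f) ` J)"
proof (rule submodI)
  show "(\<lambda>a. frob a \<otimes> f) ` J \<subseteq> carrier R" using idealD(5)[OF J] f by auto
  show "\<zero> \<in> (\<lambda>a. frob a \<otimes> f) ` J"
    using idealD(2)[OF J] f frob_zero by (auto intro!: image_eqI[of _ _ \<zero>])
  fix x y assume "x \<in> (\<lambda>a. frob a \<otimes> f) ` J" "y \<in> (\<lambda>a. frob a \<otimes> f) ` J"
  then obtain a b where ab: "a \<in> J" "b \<in> J" "x = frob a \<otimes> f" "y = frob b \<otimes> f" by auto
  then have "x \<oplus> y = frob (a \<oplus> b) \<otimes> f"
    using idealD(5)[OF J] f by (simp add: frob_add l_distr)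
  then show "x \<oplus> y \<in> (\<lambda>a. frob a \<otimes> f) ` J" using idealD(3)[OF J ab(1,2)] by blast
next
  fix s x assume "s \<in> frob ` carrier R" "x \<in> (\<lambda>a. frob a \<otimes> f) ` J"
  then obtain t a where ta: "t \<in> carrier R" "a \<in> J" "s = frob t" "x = frob a \<otimes> f" by auto
  then have "s \<otimes> x = frob (t \<otimes> a) \<otimes> f"
    using idealD(5)[OF J] f by (simp add: frob_mult m_assoc)
  then show "s \<otimes> x \<in> (\<lambda>a. frob a \<otimes> f) ` J" using idealD(4)[OF J ta(1,2)] by blast
qed

lemma submod_frob_span:
  assumes "ideal Q R" "ideal J R"
  shows "set fs \<subseteq> carrier R \<Longrightarrow> submod (frob ` carrier R) (frob_span Q J fs)"
proof (induction fs)
  case (Cons f fs)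
  then show ?case
    using submod_set_add[OF frob_carrier_subset submod_frob_image[OF assms(2)]] by auto
qed (use submod_frob_ideal assms in auto)

lemma frob_span_mono: "J \<subseteq> J' \<Longrightarrow> frob_span Q J fs \<subseteq> frob_span Q J' fs"
proof (induction fs)
  case (Cons f fs)
  then show ?case unfolding frob_span.simps by (intro set_add_mono image_mono)
qed auto

lemma subset_frob_span:
  assumes Q: "ideal Q R" and J: "ideal J R"
  shows "set fs \<subseteq> carrier R \<Longrightarrow> Q \<subseteq> frob_span Q J fs"
proof (induction fs)
  case (Cons f fs)
  have "\<zero> \<oplus> x \<in> frob_span Q J (f # fs)" if "x \<in> Q" for x
    unfolding frob_span.simps
    by (rule set_addI) (use that Cons submodD(2)[OF submod_frob_image[OF J, of f]] in auto)
  then show ?case using idealD(5)[OF Q] by fastforce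
qed auto

text \<open>Coefficientwise, z^p a^p = (z a)^p with z a in I.\<close>

lemma frob_span_mult:
  assumes Q: "ideal Q R" and I: "ideal I R" and z: "z \<in> I"
  shows "set fs \<subseteq> carrier R \<Longrightarrow> x \<in> frob_span Q (carrier R) fs \<Longrightarrow> frob z \<otimes> x \<in> frob_span Q I fs"
proof (induction fs arbitrary: x)
  case Nil
  then show ?case using idealD(4)[OF Q] idealD(5)[OF I z] by auto
next
  case (Cons f fs)
  then obtain a g where ag: "a \<in> carrier R" "g \<in> frob_span Q (carrier R) fs" "x = frob a \<otimes> f \<oplus> g"
    by (auto simp: mem_set_add_iff)
  have g: "g \<in> carrier R"
    using submodD(5)[OF submod_frob_span[OF Q oneideal] ag(2)] Cons.prems by auto
  have "frob z \<otimes> x = frob (z \<otimes> a) \<otimes> f \<oplus> frob z \<otimes> g"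
    using ag g idealD(5)[OF I z] Cons.prems by (simp add: r_distr frob_mult m_assoc)
  moreover have "z \<otimes> a \<in> I" using idealD(6)[OF I ag(1) z] .
  ultimately show ?case using Cons ag(2) by (auto intro!: set_addI)
qed

lemma frob_span_mult_subset:
  assumes I': "ideal I' R" and I: "ideal I R" and Q: "Q \<subseteq> I'" and c: "c \<in> carrier R"
    and cz: "\<And>z. z \<in> I \<Longrightarrow> c \<otimes> frob z \<in> I'"
  shows "set fs \<subseteq> carrier R \<Longrightarrow> x \<in> frob_span Q I fs \<Longrightarrow> x \<in> carrier R \<and> c \<otimes> x \<in> I'"
proof (induction fs arbitrary: x)
  case Nil
  then show ?case using Q idealD(4,5)[OF I'] c by auto
next
  case (Cons f fs)
  then obtain a g where ag: "a \<in> I" "g \<in> frob_span Q I fs" "x = frob a \<otimes> f \<oplus> g"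
    by (auto simp: mem_set_add_iff)
  have g: "g \<in> carrier R" "c \<otimes> g \<in> I'" using Cons ag by auto
  have a: "a \<in> carrier R" "f \<in> carrier R" using idealD(5)[OF I ag(1)] Cons.prems by auto
  have "c \<otimes> x = (c \<otimes> frob a) \<otimes> f \<oplus> c \<otimes> g"
    using ag g a c by (simp add: r_distr m_assoc)
  then show ?case using ag g a c cz[OF ag(1)] idealD(3,6)[OF I'] by auto
qed

text \<open>Additivity of Frobenius gives (i + d s)^p = i^p + d^p s^p, so whatever leaves the span
  over I is a multiple of d^p.\<close>

lemma frob_span_sum:
  assumes Q: "ideal Q R" and I: "ideal I R" and d: "d \<in> carrier R"
  shows "set fs \<subseteq> carrier R \<Longrightarrow>
    frob_span Q (I <+> PIdl d) fs \<subseteq> frob_span Q I fs <+> PIdl (frob d)"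
proof (induction fs)
  case Nil
  have "\<zero> \<in> PIdl (frob d)" using idealD(2)[OF cgenideal_ideal] d by auto
  then show ?case using subset_set_add[OF idealD(1)[OF Q]] by auto
next
  case (Cons f fs)
  have f: "f \<in> carrier R" using Cons by auto
  show ?case
  proof
    fix x assume "x \<in> frob_span Q (I <+> PIdl d) (f # fs)"
    then obtain a g where ag: "a \<in> I <+> PIdl d" "g \<in> frob_span Q (I <+> PIdl d) fs"
        "x = frob a \<otimes> f \<oplus> g"
      by (auto simp: mem_set_add_iff)
    then obtain i s where i: "i \<in> I" "s \<in> carrier R" "a = i \<oplus> d \<otimes> s"
      using d by (auto simp: mem_set_add_iff mem_cgenideal_iff)
    obtain h t where h: "h \<in> frob_span Q I fs" "t \<in> carrier R" "g = h \<oplus> frob d \<otimes> t"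
      using subsetD[OF Cons.IH ag(2)] Cons.prems d by (auto simp: mem_set_add_iff mem_cgenideal_iff)
    have c: "i \<in> carrier R" "h \<in> carrier R"
      using idealD(5)[OF I i(1)] submodD(5)[OF submod_frob_span[OF Q I] h(1)] Cons.prems by auto
    have "x = (frob i \<otimes> f \<oplus> h) \<oplus> frob d \<otimes> (frob s \<otimes> f \<oplus> t)"
      using c i h d f ag(3) by (simp add: frob_add frob_mult l_distr r_distr a_ac m_ac)
    moreover have "frob i \<otimes> f \<oplus> h \<in> frob_span Q I (f # fs)"
      using i h by (auto intro!: set_addI)
    moreover have "frob d \<otimes> (frob s \<otimes> f \<oplus> t) \<in> PIdl (frob d)"
      using d i h f by (auto simp: mem_cgenideal_iff)
    ultimately show "x \<in> frob_span Q I (f # fs) <+> PIdl (frob d)" by (auto intro: set_addI)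
  qed
qed

text \<open>Independence modulo Q makes the quotient a direct sum of copies of R/J, one for each
  entry of \<open>fs\<close>. In the induction the chain fJ + GJ \<subseteq> fJ + G \<subseteq> fR +
  G separates the copy that belongs to f from the others.\<close>

lemma lenS_frob_span:
  assumes P: "primeideal P R" and Q: "ideal Q R" and J: "ideal J R" and QJ: "Q \<subseteq> J"
  shows "set fs \<subseteq> carrier R \<Longrightarrow> frob_indep Q fs \<Longrightarrow>
    lenS P (frob_span Q J fs) (frob_span Q (carrier R) fs) =
      of_nat (length fs) * lenR P J (carrier R)"
proof (induction fs)
  case Nil
  then show ?case
    using rel_length_refl[OF scalars_frob[OF P] submod_frob_ideal[OF Q]] by (simp add: lenS_def)
next
  case (Cons f fs)
  have f: "f \<in> carrier R" "set fs \<subseteq> carrier R" using Cons.prems by auto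
  have indep: "\<And>a. a \<in> carrier R \<Longrightarrow> frob a \<otimes> f \<in> frob_span Q (carrier R) fs \<Longrightarrow> a \<in> Q"
    using Cons.prems by auto
  define fJ where "fJ = (\<lambda>a. frob a \<otimes> f) ` J"
  define fR where "fR = (\<lambda>a. frob a \<otimes> f) ` carrier R"
  define GJ where "GJ = frob_span Q J fs"
  define G where "G = frob_span Q (carrier R) fs"
  note sub = submod_frob_image[OF J f(1), folded fJ_def] submod_frob_image[OF oneideal f(1), folded fR_def]
    submod_frob_span[OF Q J f(2), folded GJ_def] submod_frob_span[OF Q oneideal f(2), folded G_def]
  note subc = sub[THEN submodD(5)] and sub0 = sub[THEN submodD(2)]
  note add = submod_set_add[OF frob_carrier_subset]
  have GJG: "GJ \<subseteq> G" unfolding GJ_def G_def by (rule frob_span_mono[OF idealD(1)[OF J]])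
  have fJR: "fJ \<subseteq> fR" using idealD(1)[OF J] by (auto simp: fJ_def fR_def)
  have N: "submod (frob ` carrier R) (fJ <+> G)" using add sub by blast
  have "lenS P (fJ <+> GJ) (fR <+> G) =
      lenS P (fJ <+> GJ) (fJ <+> G) + lenS P (fJ <+> G) (fR <+> G)"
    by (intro lenS_add[OF P] add sub set_add_mono order_refl GJG fJR)
  moreover have "lenS P (fJ <+> G) (fR <+> G) = lenR P J (carrier R)"
  proof -
    have "(fJ <+> G) <+> fR \<subseteq> fR <+> G"
      by (rule set_add_least[OF add[OF sub(2,4)] set_add_mono[OF fJR order_refl]
            subset_set_add[OF submodD(1)[OF sub(2)] sub0(4)]])
    moreover have "fR <+> G \<subseteq> (fJ <+> G) <+> fR"
    proof
      fix x assume "x \<in> fR <+> G"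
      then obtain r g where rg: "r \<in> fR" "g \<in> G" "x = r \<oplus> g" by (auto simp: mem_set_add_iff)
      then have "x = (\<zero> \<oplus> g) \<oplus> r" using subc by (simp add: a_comm)
      then show "x \<in> (fJ <+> G) <+> fR" using rg sub0(1) by (auto intro!: set_addI)
    qed
    ultimately have *: "(fJ <+> G) <+> (\<lambda>a. frob a \<otimes> f) ` carrier R = fR <+> G"
      by (auto simp: fR_def)
    \<comment> \<open>This is the kernel of a \<mapsto> a^p f into the upper quotient: if a^p f -
      j^p f lies in G, independence puts a - j into Q, hence into J.\<close>
    have "{a \<in> carrier R. frob a \<otimes> f \<in> fJ <+> G} = J"
    proof (intro equalityI subsetI)
      fix a assume "a \<in> {a \<in> carrier R. frob a \<otimes> f \<in> fJ <+> G}"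
      then obtain j g where j: "a \<in> carrier R" "j \<in> J" "g \<in> G" "frob a \<otimes> f = frob j \<otimes> f \<oplus> g"
        by (auto simp: mem_set_add_iff fJ_def)
      have jc: "j \<in> carrier R" using idealD(5)[OF J j(2)] .
      have "frob (a \<ominus> j) \<otimes> f = frob a \<otimes> f \<ominus> frob j \<otimes> f"
        unfolding frob_minus[OF j(1) jc] using j jc f by (simp add: a_minus_def l_distr l_minus)
      also have "\<dots> = g" using j jc f subc(4)[OF j(3)] by (simp add: add_minus_cancel_left)
      finally have "a \<ominus> j \<in> J" using indep[of "a \<ominus> j"] j jc QJ by (auto simp: G_def)
      then have "(a \<ominus> j) \<oplus> j \<in> J" using idealD(3)[OF J] j by blast
      then show "a \<in> J" using j jc by (simp add: a_minus_def a_assoc l_neg)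
    next
      fix a assume a: "a \<in> J"
      then have "frob a \<otimes> f \<oplus> \<zero> \<in> fJ <+> G" using sub0(4) by (auto simp: fJ_def intro!: set_addI)
      then show "a \<in> {a \<in> carrier R. frob a \<otimes> f \<in> fJ <+> G}" using idealD(5)[OF J a] f by auto
    qed
    moreover have "rel_length (carrier R) (carrier R - P) {a \<in> carrier R. frob a \<otimes> f \<in> fJ <+> G} (carrier R) =
       rel_length (frob ` carrier R) (frob ` (carrier R - P)) (fJ <+> G)
         ((fJ <+> G) <+> (\<lambda>a. frob a \<otimes> f) ` carrier R)"
      by (rule rel_length_map[OF scalars_prime[OF P] scalars_frob[OF P] _ N, where \<tau> = frob])
        (use f in \<open>auto simp: submod_carrier_iff oneideal frob_add frob_mult l_distr m_assoc\<close>)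
    ultimately show ?thesis using * by (simp add: lenS_def lenR_def)
  qed
  moreover have "lenS P (fJ <+> GJ) (fJ <+> G) = lenS P GJ G"
  proof -
    have B: "submod (frob ` carrier R) (fJ <+> GJ)" using add sub by blast
    \<comment> \<open>A summand j^p f that lies in G forces j \<in> Q, so this summand lies in Q and
      already belongs to GJ.\<close>
    have "{a \<in> G. a \<in> fJ <+> GJ} = GJ"
    proof (intro equalityI subsetI)
      fix x assume "x \<in> {a \<in> G. a \<in> fJ <+> GJ}"
      then obtain j g where j: "x \<in> G" "j \<in> J" "g \<in> GJ" "x = frob j \<otimes> f \<oplus> g"
        by (auto simp: mem_set_add_iff fJ_def)
      have jc: "j \<in> carrier R" using idealD(5)[OF J j(2)] .
      have "x \<ominus> g \<in> G" using submod_minus[OF scalars_frob[OF P] sub(4)] j GJG by blast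
      moreover have "x \<ominus> g = frob j \<otimes> f"
        using j jc f subc(3)[OF j(3)] by (simp add: a_minus_def a_assoc r_neg)
      ultimately have "j \<in> Q" using indep[OF jc] by (simp add: G_def)
      then have "frob j \<otimes> f \<in> Q" using frob_in_ideal[OF Q] idealD(6)[OF Q f(1)] by blast
      then have "frob j \<otimes> f \<in> GJ" using subset_frob_span[OF Q J f(2)] by (auto simp: GJ_def)
      then show "x \<in> GJ" using submodD(3)[OF sub(3)] j by auto
    next
      fix x assume x: "x \<in> GJ"
      then have "\<zero> \<oplus> x \<in> fJ <+> GJ" using sub0(1) by (intro set_addI)
      then show "x \<in> {a \<in> G. a \<in> fJ <+> GJ}" using x GJG subc(3)[OF x] by auto
    qed
    moreover have "(fJ <+> GJ) <+> G = fJ <+> G"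
    proof
      have "G \<subseteq> fJ <+> G"
        using subset_set_add[OF submodD(1)[OF sub(4)] sub0(1)]
          set_add_commute[OF submodD(1)[OF sub(1)] submodD(1)[OF sub(4)]] by simp
      then show "(fJ <+> GJ) <+> G \<subseteq> fJ <+> G"
        by (rule set_add_least[OF N set_add_mono[OF order_refl GJG]])
      show "fJ <+> G \<subseteq> (fJ <+> GJ) <+> G"
        using subset_set_add[OF submodD(1)[OF sub(1)] sub0(3)] by (intro set_add_mono) auto
    qed
    moreover have "rel_length (frob ` carrier R) (frob ` (carrier R - P)) {a \<in> G. a \<in> fJ <+> GJ} G =
       rel_length (frob ` carrier R) (frob ` (carrier R - P)) (fJ <+> GJ)
         ((fJ <+> GJ) <+> (\<lambda>a. a) ` G)"
      by (rule rel_length_map[OF scalars_frob[OF P] scalars_frob[OF P] sub(4) B, where \<tau> = id])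
        (use subc(4) in auto)
    ultimately show ?thesis by (simp add: lenS_def)
  qed
  ultimately show ?case
    using Cons by (simp add: fJ_def fR_def GJ_def G_def distrib_right add.commute)
qed

text \<open>The length of \<open>fs\<close> is the rank of \<open>F\<^sub>*(R/Q)\<close> over \<open>R/Q\<close>: off the locus \<open>b = 0\<close> it is free on \<open>fs\<close>.\<close>

definition frob_frame :: "'a set \<Rightarrow> 'a list \<Rightarrow> 'a \<Rightarrow> bool" where
  "frob_frame Q fs b \<longleftrightarrow> set fs \<subseteq> carrier R \<and> frob_indep Q fs \<and> b \<in> carrier R \<and> b \<notin> Q \<and>
     (\<forall>x\<in>carrier R. frob b \<otimes> x \<in> frob_span Q (carrier R) fs)"

section \<open>Existence and use of frames\<close>

lemma frob_frameD:
  assumes "frob_frame Q fs b"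
  shows "set fs \<subseteq> carrier R" "frob_indep Q fs" "b \<in> carrier R" "b \<notin> Q"
    "\<And>x. x \<in> carrier R \<Longrightarrow> frob b \<otimes> x \<in> frob_span Q (carrier R) fs"
  using assms unfolding frob_frame_def by auto

text \<open>Thins out a spanning list: a new t with a^p t in the current span for some a outside Q
  is dropped, at the price of replacing b by ab; otherwise t is kept. Primality of Q keeps ab
  outside Q.\<close>

lemma frob_frame_exists:
  assumes Q: "primeideal Q R" and ts: "set ts \<subseteq> carrier R"
    and span: "\<And>x. x \<in> carrier R \<Longrightarrow> x \<in> frob_span Q (carrier R) ts"
  shows "\<exists>fs b. frob_frame Q fs b"
proof -
  note Qi = primeD(1)[OF Q]
  have "\<exists>fs b. set fs \<subseteq> carrier R \<and> frob_indep Q fs \<and> b \<in> carrier R \<and> b \<notin> Q \<and>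
     (\<forall>x\<in>frob_span Q (carrier R) ts. frob b \<otimes> x \<in> frob_span Q (carrier R) fs)"
    using ts
  proof (induction ts)
    case Nil
    have "\<forall>x\<in>Q. frob \<one> \<otimes> x \<in> Q" using idealD(5)[OF Qi] by simp
    then show ?case using primeD(2)[OF Q] by (intro exI[of _ "[]"] exI[of _ \<one>]) auto
  next
    case (Cons t ts)
    then obtain fs b where fs: "set fs \<subseteq> carrier R" "frob_indep Q fs" "b \<in> carrier R" "b \<notin> Q"
      and b: "\<And>x. x \<in> frob_span Q (carrier R) ts \<Longrightarrow> frob b \<otimes> x \<in> frob_span Q (carrier R) fs"
      by auto
    have t: "t \<in> carrier R" "set ts \<subseteq> carrier R" using Cons.prems by auto
    note subts = submod_frob_span[OF Qi oneideal t(2)] and subfs = submod_frob_span[OF Qi oneideal fs(1)]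
    show ?case
    proof (cases "\<exists>a\<in>carrier R. a \<notin> Q \<and> frob a \<otimes> t \<in> frob_span Q (carrier R) fs")
      case True
      then obtain a where a: "a \<in> carrier R" "a \<notin> Q" "frob a \<otimes> t \<in> frob_span Q (carrier R) fs" by auto
      have "frob (a \<otimes> b) \<otimes> x \<in> frob_span Q (carrier R) fs"
        if "x \<in> frob_span Q (carrier R) (t # ts)" for x
      proof -
        from that obtain s g where sg: "s \<in> carrier R" "g \<in> frob_span Q (carrier R) ts"
            "x = frob s \<otimes> t \<oplus> g"
          by (auto simp: mem_set_add_iff)
        have g: "g \<in> carrier R" using submodD(5)[OF subts sg(2)] .
        have "frob (a \<otimes> b) \<otimes> x = frob (b \<otimes> s) \<otimes> (frob a \<otimes> t) \<oplus> frob a \<otimes> (frob b \<otimes> g)"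
          using sg g a fs t by (simp add: frob_mult r_distr m_ac)
        moreover have "frob (b \<otimes> s) \<otimes> (frob a \<otimes> t) \<in> frob_span Q (carrier R) fs"
          using submodD(4)[OF subfs _ a(3)] fs sg by blast
        moreover have "frob a \<otimes> (frob b \<otimes> g) \<in> frob_span Q (carrier R) fs"
          using submodD(4)[OF subfs _ b[OF sg(2)]] a by blast
        ultimately show ?thesis using submodD(3)[OF subfs] by simp
      qed
      moreover have "a \<otimes> b \<in> carrier R" "a \<otimes> b \<notin> Q" using a fs primeD(3)[OF Q] by auto
      ultimately show ?thesis using fs by (intro exI[of _ fs] exI[of _ "a \<otimes> b"]) auto
    next
      case False
      have "frob b \<otimes> x \<in> frob_span Q (carrier R) (t # fs)"
        if "x \<in> frob_span Q (carrier R) (t # ts)" for x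
      proof -
        from that obtain s g where sg: "s \<in> carrier R" "g \<in> frob_span Q (carrier R) ts"
            "x = frob s \<otimes> t \<oplus> g"
          by (auto simp: mem_set_add_iff)
        have g: "g \<in> carrier R" using submodD(5)[OF subts sg(2)] .
        have "frob b \<otimes> x = frob (b \<otimes> s) \<otimes> t \<oplus> frob b \<otimes> g"
          using sg g fs t by (simp add: frob_mult r_distr m_ac)
        then show ?thesis using b[OF sg(2)] fs sg by (auto intro!: set_addI)
      qed
      then show ?thesis using fs False t by (intro exI[of _ "t # fs"] exI[of _ b]) auto
    qed
  qed
  then show ?thesis using span unfolding frob_frame_def by blast
qed

text \<open>The span with coefficients in P collapses to P, so \<open>lenS_frob_span\<close> counts
  the frame, and b^p makes the remaining quotient vanish at P. The value is [k : k^p] for the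
  residue field k at P.\<close>

lemma lenS_frame:
  assumes P: "primeideal P R" and fr: "frob_frame P fs b"
  shows "lenS P P (carrier R) = of_nat (length fs)"
proof -
  note Pi = primeD(1)[OF P] and fs = frob_frameD[OF fr]
  define G where "G = frob_span P (carrier R) fs"
  have G: "submod (frob ` carrier R) G" unfolding G_def by (rule submod_frob_span[OF Pi oneideal fs(1)])
  have PG: "P \<subseteq> G" unfolding G_def by (rule subset_frob_span[OF Pi oneideal fs(1)])
  have "frob_span P P fs \<subseteq> P"
    using frob_span_mult_subset[OF Pi Pi order_refl one_closed _ fs(1)] frob_in_ideal[OF Pi]
      idealD(5)[OF Pi] by (metis l_one nat_pow_closed subsetI)
  with subset_frob_span[OF Pi Pi fs(1)] have "frob_span P P fs = P" by auto
  then have "lenS P P G = of_nat (length fs)"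
    using lenS_frob_span[OF P Pi Pi order_refl fs(1,2)] lenR_prime[OF P] by (simp add: G_def)
  moreover have "absorbs (frob ` (carrier R - P)) G (carrier R)"
    unfolding absorbs_def using fs by (auto simp: G_def)
  then have "lenS P G (carrier R) = 0"
    unfolding lenS_def
    using rel_length_eq_0_iff[OF submod_frob_ideal[OF oneideal] submodD(1)[OF G]] by blast
  ultimately show ?thesis
    using lenS_add[OF P submod_frob_ideal[OF Pi] G submod_frob_ideal[OF oneideal] PG submodD(1)[OF G]]
    by simp
qed

text \<open>I^[p] is an ideal of R, whereas the span is only stable under p-th powers. The factor s
  in \<open>N\<close> makes up for this: N is an ideal, and it contains the generators z^p.\<close>

lemma frobenius_power_frame:
  assumes Q: "ideal Q R" and I: "ideal I R" and fr: "frob_frame Q fs b"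
    and x: "x \<in> frobenius_power R p I"
  shows "frob b \<otimes> x \<in> frob_span Q I fs"
proof -
  note fs = frob_frameD[OF fr]
  note G = submod_frob_span[OF Q I fs(1)]
  define N where "N = {w \<in> carrier R. \<forall>s\<in>carrier R. frob b \<otimes> (s \<otimes> w) \<in> frob_span Q I fs}"
  have "submod (carrier R) N"
  proof (rule submodI)
    show "\<zero> \<in> N" using submodD(2)[OF G] fs by (simp add: N_def)
    show "v \<oplus> w \<in> N" if "v \<in> N" "w \<in> N" for v w
      using that submodD(3)[OF G] fs(3) by (simp add: N_def r_distr)
    show "t \<otimes> w \<in> N" if "t \<in> carrier R" "w \<in> N" for t w
    proof -
      have "frob b \<otimes> (s \<otimes> (t \<otimes> w)) \<in> frob_span Q I fs" if "s \<in> carrier R" for s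
        using that \<open>t \<in> carrier R\<close> \<open>w \<in> N\<close> fs(3) m_closed[of s t]
        by (auto simp: N_def m_assoc[symmetric] simp del: m_closed)
      then show ?thesis using that by (simp add: N_def)
    qed
  qed (auto simp: N_def)
  then have "ideal N R" by (simp add: submod_carrier_iff)
  moreover have "frob ` I \<subseteq> N"
  proof
    fix w assume "w \<in> frob ` I"
    then obtain z where z: "z \<in> I" "w = frob z" by auto
    have zc: "z \<in> carrier R" using idealD(5)[OF I z(1)] .
    have "frob b \<otimes> (s \<otimes> w) \<in> frob_span Q I fs" if s: "s \<in> carrier R" for s
    proof -
      have "frob z \<otimes> (frob b \<otimes> s) \<in> frob_span Q I fs"
        by (rule frob_span_mult[OF Q I z(1) fs(1) fs(5)[OF s]])
      then show ?thesis using s z zc fs(3) by (simp add: m_ac)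
    qed
    then show "w \<in> N" using z zc by (simp add: N_def)
  qed
  ultimately have "x \<in> N" using x genideal_minimal unfolding frobenius_power_def by blast
  then have "frob b \<otimes> (\<one> \<otimes> x) \<in> frob_span Q I fs" unfolding N_def by blast
  then show ?thesis using \<open>x \<in> N\<close> by (simp add: N_def)
qed

text \<open>Multiplication by \<open>c b\<^sup>p\<close> maps \<open>R\<close> into the free part and \<open>I'\<close> into its submodule attached to \<open>I\<close>.\<close>

lemma length_lower_frob:
  assumes P: "primeideal P R" and Q: "ideal Q R"
    and fr: "frob_frame Q fs b" and r: "lenS P P (carrier R) = of_nat r"
    and I: "ideal I R" "Q \<subseteq> I" and I': "ideal I' R" and c: "c \<in> carrier R"
    and cI: "\<And>z. z \<in> I' \<Longrightarrow> c \<otimes> z \<in> frobenius_power R p I"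
    and n: "lenR P I' (carrier R) = of_nat n"
  shows "of_nat (length fs) * lenR P I (carrier R) \<le>
    of_nat r * of_nat n + of_nat (length fs) * lenR P (I <+> PIdl (c \<otimes> b)) (carrier R)"
proof -
  note fs = frob_frameD[OF fr]
  define G where "G = frob_span Q (carrier R) fs"
  define B where "B = frob_span Q I fs"
  define x where "x = c \<otimes> frob b"
  have x: "x \<in> carrier R" using c fs by (simp add: x_def)
  have subG: "submod (frob ` carrier R) G" and subB: "submod (frob ` carrier R) B"
    unfolding G_def B_def using submod_frob_span Q oneideal I fs by blast+
  have BG: "B \<subseteq> G" unfolding G_def B_def by (rule frob_span_mono[OF idealD(1)[OF I(1)]])
  have xid: "ideal (PIdl x) R" using cgenideal_ideal x by blast
  define M where "M = B <+> PIdl x"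
  have M: "submod (frob ` carrier R) M"
    unfolding M_def by (rule submod_set_add[OF frob_carrier_subset subB submod_frob_ideal[OF xid]])
  have BM: "B \<subseteq> M" unfolding M_def using subset_set_add submodD(1)[OF subB] idealD(2)[OF xid] by blast
  have "PIdl x \<subseteq> G"
  proof
    fix w assume "w \<in> PIdl x"
    then obtain s where s: "s \<in> carrier R" "w = x \<otimes> s" using x by (auto simp: mem_cgenideal_iff)
    then have "w = frob b \<otimes> (c \<otimes> s)" using c fs by (simp add: x_def m_ac)
    then show "w \<in> G" using fs(5)[of "c \<otimes> s"] c s by (simp add: G_def)
  qed
  then have MG: "M \<subseteq> G" unfolding M_def by (rule set_add_least[OF subG BG])
  have "lenS P B M = lenS P {a \<in> carrier R. x \<otimes> a \<in> B} (carrier R)"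
    unfolding lenS_def M_def image_mult_carrier[OF x, symmetric]
    by (rule rel_length_mult[symmetric, OF scalars_frob[OF P] submod_frob_ideal[OF oneideal] subB x])
  also have "\<dots> \<le> lenS P I' (carrier R)"
  proof (rule lenS_mono[OF _ order_refl], rule subsetI)
    fix z assume z: "z \<in> I'"
    then have zc: "z \<in> carrier R" using idealD(5)[OF I'] by blast
    have "frob b \<otimes> (c \<otimes> z) \<in> B"
      unfolding B_def by (rule frobenius_power_frame[OF Q I(1) fr cI[OF z]])
    then show "z \<in> {a \<in> carrier R. x \<otimes> a \<in> B}" using zc c fs by (simp add: x_def m_ac)
  qed
  also have "\<dots> = of_nat r * of_nat n"
    using lenS_eq_mult_lenR[OF P r oneideal I' idealD(1)[OF I']] n by (simp add: of_nat_eq_enat)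
  finally have 1: "lenS P B M \<le> of_nat r * of_nat n" .
  \<comment> \<open>The cokernel G/M is measured by I + dR: (cb)^p is a multiple of x = c b^p, as c
    divides c^p, so the span over I + dR lies in M.\<close>
  define d where "d = c \<otimes> b"
  have d: "d \<in> carrier R" using c fs by (simp add: d_def)
  note Id = set_add_cgenideal_upper[OF I(1) d]
  have "PIdl (frob d) \<subseteq> PIdl x"
  proof (rule cgenideal_minimal[OF xid])
    obtain s where s: "s \<in> carrier R" "frob c = s \<otimes> c" using frob_factor[OF c] by auto
    then have "frob d = x \<otimes> s" using c fs by (simp add: d_def x_def frob_mult m_ac)
    then show "frob d \<in> PIdl x" using x s by (auto simp: mem_cgenideal_iff)
  qed
  then have "frob_span Q (I <+> PIdl d) fs \<subseteq> M"
    using frob_span_sum[OF Q I(1) d fs(1)] set_add_mono[of B B "PIdl (frob d)" "PIdl x"]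
    by (auto simp: M_def B_def)
  then have "lenS P M G \<le> lenS P (frob_span Q (I <+> PIdl d) fs) G"
    by (rule lenS_mono) simp
  also have "\<dots> = of_nat (length fs) * lenR P (I <+> PIdl d) (carrier R)"
    unfolding G_def using I(2) Id by (intro lenS_frob_span P Q fs) auto
  finally have 2: "lenS P M G \<le> of_nat (length fs) * lenR P (I <+> PIdl d) (carrier R)" .
  have "of_nat (length fs) * lenR P I (carrier R) = lenS P B G"
    unfolding G_def B_def by (rule lenS_frob_span[symmetric, OF P Q I fs(1,2)])
  also have "\<dots> = lenS P B M + lenS P M G"
    by (rule lenS_add[OF P subB M subG BM MG])
  finally show ?thesis using add_mono[OF 1 2] by (simp add: d_def)
qed

text \<open>Here \<open>c\<close> maps the free part into \<open>R\<close>, with cokernel killed by \<open>c b\<^sup>p\<close>.\<close>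

lemma length_upper_frob:
  assumes P: "primeideal P R" and Q: "ideal Q R"
    and fr: "frob_frame Q fs b" and r: "lenS P P (carrier R) = of_nat r"
    and I: "ideal I R" "Q \<subseteq> I" and I': "ideal I' R" "Q \<subseteq> I'" and c: "c \<in> carrier R"
    and cI: "\<And>z. z \<in> I \<Longrightarrow> c \<otimes> frob z \<in> I'"
    and n: "lenR P I' (carrier R) = of_nat n"
  shows "of_nat r * of_nat n \<le> of_nat (length fs) * lenR P I (carrier R) +
    of_nat r * lenR P (I' <+> PIdl (c \<otimes> frob b)) (carrier R)"
proof -
  note fs = frob_frameD[OF fr]
  define G where "G = frob_span Q (carrier R) fs"
  have subG: "submod (frob ` carrier R) G"
    unfolding G_def using submod_frob_span Q oneideal fs by blast
  define M where "M = I' <+> (\<otimes>) c ` G"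
  define x where "x = c \<otimes> frob b"
  have x: "x \<in> carrier R" using c fs by (simp add: x_def)
  note I'x = set_add_cgenideal_upper[OF I'(1) x]
  have cG: "submod (frob ` carrier R) ((\<otimes>) c ` G)"
  proof (rule submodI)
    show "(\<otimes>) c ` G \<subseteq> carrier R" using c submodD(5)[OF subG] by auto
    show "\<zero> \<in> (\<otimes>) c ` G" using c submodD(2)[OF subG] by (auto intro!: image_eqI[of _ _ \<zero>])
    fix u v assume "u \<in> (\<otimes>) c ` G" "v \<in> (\<otimes>) c ` G"
    then obtain g h where gh: "g \<in> G" "h \<in> G" "u = c \<otimes> g" "v = c \<otimes> h" by auto
    then have "u \<oplus> v = c \<otimes> (g \<oplus> h)" using c submodD(5)[OF subG] by (simp add: r_distr)
    then show "u \<oplus> v \<in> (\<otimes>) c ` G" using submodD(3)[OF subG gh(1,2)] by blast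
  next
    fix s u assume s: "s \<in> frob ` carrier R" and "u \<in> (\<otimes>) c ` G"
    then obtain g where g: "g \<in> G" "u = c \<otimes> g" by auto
    then have "s \<otimes> u = c \<otimes> (s \<otimes> g)" using c s submodD(5)[OF subG] by (auto simp: m_lcomm)
    then show "s \<otimes> u \<in> (\<otimes>) c ` G" using submodD(4)[OF subG s g(1)] by blast
  qed
  have M: "submod (frob ` carrier R) M"
    unfolding M_def by (rule submod_set_add[OF frob_carrier_subset submod_frob_ideal[OF I'(1)] cG])
  have IM: "I' \<subseteq> M"
    unfolding M_def using subset_set_add[OF idealD(1)[OF I'(1)] submodD(2)[OF cG]] .
  have "lenS P I' M = lenS P {a \<in> G. c \<otimes> a \<in> I'} G"
    unfolding lenS_def M_def
    by (rule rel_length_mult[symmetric, OF scalars_frob[OF P] subG submod_frob_ideal[OF I'(1)] c])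
  also have "\<dots> \<le> lenS P (frob_span Q I fs) G"
  proof (rule lenS_mono[OF _ order_refl], rule subsetI)
    fix z assume z: "z \<in> frob_span Q I fs"
    then have "z \<in> G" unfolding G_def using frob_span_mono[OF idealD(1)[OF I(1)]] by blast
    moreover have "c \<otimes> z \<in> I'"
      using frob_span_mult_subset[OF I'(1) I(1) I'(2) c cI fs(1) z] by blast
    ultimately show "z \<in> {a \<in> G. c \<otimes> a \<in> I'}" by blast
  qed
  also have "\<dots> = of_nat (length fs) * lenR P I (carrier R)"
    unfolding G_def by (rule lenS_frob_span[OF P Q I fs(1,2)])
  finally have 1: "lenS P I' M \<le> of_nat (length fs) * lenR P I (carrier R)" .
  have "PIdl x \<subseteq> (\<otimes>) c ` G"
  proof
    fix w assume "w \<in> PIdl x"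
    then obtain s where s: "s \<in> carrier R" "w = x \<otimes> s" using x by (auto simp: mem_cgenideal_iff)
    then have "w = c \<otimes> (frob b \<otimes> s)" using c fs by (simp add: x_def m_ac)
    then show "w \<in> (\<otimes>) c ` G" using fs(5)[OF s(1)] by (simp add: G_def)
  qed
  then have "lenS P M (carrier R) \<le> lenS P (I' <+> PIdl x) (carrier R)"
    unfolding M_def by (intro lenS_mono set_add_mono) auto
  also have "\<dots> = of_nat r * lenR P (I' <+> PIdl x) (carrier R)"
  proof -
    \<comment> \<open>\<open>lenS_eq_mult_lenR\<close> asks for a finite length, which is inherited
      from I'.\<close>
    have "lenR P (I' <+> PIdl x) (carrier R) \<le> of_nat n"
      unfolding n[symmetric] by (rule lenR_mono[OF I'x(1)])
    then obtain m where m: "lenR P (I' <+> PIdl x) (carrier R) = enat m"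
      by (cases "lenR P (I' <+> PIdl x) (carrier R)") (auto simp: of_nat_eq_enat)
    then show ?thesis
      using lenS_eq_mult_lenR[OF P r oneideal I'x(3) idealD(1)[OF I'x(3)] m] by (simp add: of_nat_eq_enat)
  qed
  finally have 2: "lenS P M (carrier R) \<le> of_nat r * lenR P (I' <+> PIdl x) (carrier R)" .
  have "of_nat r * of_nat n = lenS P I' (carrier R)"
    using lenS_eq_mult_lenR[OF P r oneideal I'(1) idealD(1)[OF I'(1)]] n by (simp add: of_nat_eq_enat)
  also have "\<dots> = lenS P I' M + lenS P M (carrier R)"
    by (rule lenS_add[OF P submod_frob_ideal[OF I'(1)] M submod_frob_ideal[OF oneideal] IM submodD(1)[OF M]])
  finally show ?thesis using add_mono[OF 1 2] by (simp add: x_def)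
qed

subsection \<open>Ranks along a chain of primes\<close>

text \<open>Apply \<open>length_upper_frob\<close> with c = 1 to Q + (x^n) and Q + (x^(pn)). Both
  colengths are linear in n by \<open>lenR_pow_eq\<close>, while the error term stays below the
  colength M of Q + (b^p); for large n only the leading coefficients matter.\<close>

lemma frob_rank_step:
  assumes noeth: "noetherian_ring R" and P: "primeideal P R" and Q: "primeideal Q R"
    and QP: "Q \<subset> P" and adj: "\<And>P'. primeideal P' R \<Longrightarrow> Q \<subset> P' \<Longrightarrow> P' \<subseteq> P \<Longrightarrow> P' = P"
    and fs: "frob_frame Q fs b" and gs: "frob_frame P gs b'"
  shows "p * length gs \<le> length fs"
proof -
  note Qi = primeD(1)[OF Q] and r = lenS_frame[OF P gs] and b = frob_frameD[OF fs]
  obtain x where x: "x \<in> P" "x \<notin> Q" "x \<in> carrier R" using QP idealD(5)[OF primeD(1)[OF P]] by blast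
  note X = set_add_cgenideal_upper[OF Qi]
  have QI: "Q \<subset> Q <+> PIdl y" if "y \<in> carrier R" "y \<notin> Q" for y
    using X[OF that(1)] that by blast
  \<comment> \<open>Containment in P makes the colength N positive, and adjacency of Q and P makes
    it finite.\<close>
  have "Q <+> PIdl x \<subseteq> P"
    using set_add_cgenideal_least[OF primeD(1)[OF P]] QP x by blast
  then have "lenR P P (carrier R) \<le> lenR P (Q <+> PIdl x) (carrier R)"
    by (rule lenR_mono)
  moreover have "lenR P (Q <+> PIdl x) (carrier R) \<noteq> \<infinity>"
    by (rule lenR_finite[OF noeth P adj X(3)[OF x(3)] QI[OF x(3,2)]])
  ultimately obtain N where N: "lenR P (Q <+> PIdl x) (carrier R) = enat N" "N \<ge> 1"
    unfolding lenR_prime[OF P]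
    by (cases "lenR P (Q <+> PIdl x) (carrier R)") (auto simp: one_enat_def)
  have fb: "frob b \<in> carrier R" "frob b \<notin> Q" using prime_pow_notin[OF Q] b by auto
  then have "lenR P (Q <+> PIdl (frob b)) (carrier R) \<noteq> \<infinity>"
    by (intro lenR_finite[OF noeth P adj X(3) QI])
  then obtain M where M: "lenR P (Q <+> PIdl (frob b)) (carrier R) = enat M" by auto
  have ineq: "length gs * (p * n * N) \<le> length fs * (n * N) + length gs * M" for n
  proof -
    define I where "I = Q <+> PIdl (x [^] n)"
    define I' where "I' = Q <+> PIdl (x [^] (p * n))"
    have I: "Q \<subseteq> I" "ideal I R" and I': "Q \<subseteq> I'" "x [^] (p * n) \<in> I'" "ideal I' R"
      unfolding I_def I'_def using X x by auto
    have z: "\<one> \<otimes> frob z \<in> I'" if z: "z \<in> I" for z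
    proof -
      obtain q s where qs: "q \<in> Q" "s \<in> carrier R" "z = q \<oplus> x [^] n \<otimes> s"
        using z x by (auto simp: I_def mem_set_add_iff mem_cgenideal_iff)
      have q: "q \<in> carrier R" using idealD(5)[OF Qi qs(1)] .
      have "frob z = frob q \<oplus> x [^] (p * n) \<otimes> frob s"
        using qs q x by (simp add: frob_add frob_mult nat_pow_pow mult.commute)
      moreover have "frob q \<in> I'" using frob_in_ideal[OF Qi qs(1)] I' by blast
      ultimately show ?thesis
        using idealD(3,6)[OF I'(3)] I'(2) qs q x by simp
    qed
    have "lenR P I' (carrier R) = of_nat (p * n * N)"
      unfolding I'_def lenR_pow_eq[OF P Q x(3,2)] N by (simp add: of_nat_eq_enat)
    from length_upper_frob[OF P Qi fs r I(2,1) I'(3,1) one_closed z this]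
    have "of_nat (length gs) * of_nat (p * n * N) \<le> of_nat (length fs) * lenR P I (carrier R) +
        of_nat (length gs) * lenR P (I' <+> PIdl (frob b)) (carrier R)"
      using fb by simp
    also have "lenR P I (carrier R) = of_nat (n * N)"
      unfolding I_def lenR_pow_eq[OF P Q x(3,2)] N by (simp add: of_nat_eq_enat)
    also have "lenR P (I' <+> PIdl (frob b)) (carrier R) \<le> enat M"
      unfolding M[symmetric] using I' by (intro lenR_mono set_add_mono) auto
    finally show ?thesis
      by (simp add: of_nat_eq_enat add_left_mono mult_left_mono)
  qed
  show ?thesis
  proof (rule ccontr)
    assume "\<not> ?thesis"
    then have less: "length fs + 1 \<le> p * length gs" by simp
    \<comment> \<open>As N \<ge> 1, this n makes n N exceed \<open>length gs * M\<close>.\<close>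
    define n where "n = length gs * M + 1"
    have "(length fs + 1) * (n * N) \<le> (p * length gs) * (n * N)"
      using less by (rule mult_le_mono1)
    also have "\<dots> \<le> length fs * (n * N) + length gs * M"
      using ineq[of n] by (simp add: mult_ac)
    finally have "n * N \<le> length gs * M" by (simp add: algebra_simps)
    moreover have "n * 1 \<le> n * N" using N(2) by (rule mult_le_mono2)
    ultimately show False by (simp add: n_def)
  qed
qed

text \<open>Induction on the length of a longest chain from Q up to P. Its second prime Q1 is
  adjacent to Q, since a prime strictly between would lengthen the chain, so passing from Q1 to Q
  multiplies the rank by at least p. For n = 0 the primes coincide and both frames count the same
  length.\<close>

lemma frob_rank_chain:
  assumes noeth: "noetherian_ring R" and P: "primeideal P R" and gs: "frob_frame P gs b'"
    and ex: "\<And>Q. primeideal Q R \<Longrightarrow> \<exists>fs b. frob_frame Q fs b"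
  shows "primeideal Q R \<Longrightarrow> prime_chain P n Q \<Longrightarrow> \<not> prime_chain P (Suc n) Q \<Longrightarrow>
    frob_frame Q fs b \<Longrightarrow> p ^ n * length gs \<le> length fs"
proof (induction n arbitrary: Q fs b)
  case 0
  have "Q \<subseteq> P" using 0(2) unfolding prime_chain_def by auto
  moreover have "\<not> Q \<subset> P"
  proof
    assume "Q \<subset> P"
    moreover have "prime_chain P 0 P" using P by (auto simp: prime_chain_def)
    ultimately show False using prime_chain_Suc[OF 0(1)] 0(3) by blast
  qed
  ultimately have "Q = P" by auto
  then have "of_nat (length gs) = (of_nat (length fs) :: enat)"
    using lenS_frame[OF P] gs 0 by metis
  then show ?case by (simp add: of_nat_eq_enat)
next
  case (Suc n)
  then obtain C where C: "\<And>i. i \<le> Suc n \<Longrightarrow> primeideal (C i) R \<and> Q \<subseteq> C i \<and> C i \<subseteq> P"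
      "\<And>i. i < Suc n \<Longrightarrow> C i \<subset> C (Suc i)"
    unfolding prime_chain_def by blast
  define Q1 where "Q1 = C 1"
  have Q1: "primeideal Q1 R" "Q \<subset> Q1" "Q1 \<subseteq> P" using C(1)[of 0] C(1)[of 1] C(2)[of 0] by (auto simp: Q1_def)
  have mono: "C 1 \<subseteq> C (Suc i)" if "i \<le> n" for i
    using that
  proof (induction i)
    case (Suc i)
    then show ?case using C(2)[of "Suc i"] by auto
  qed simp
  have chain: "prime_chain P n Q1"
    unfolding prime_chain_def Q1_def using C mono
    by (intro exI[of _ "\<lambda>i. C (Suc i)"]) auto
  have nochain: "\<not> prime_chain P (Suc n) Q1"
    using prime_chain_Suc[OF Suc.prems(1) Q1(2,3)] Suc.prems(3) by blast
  have adj: "P' = Q1" if P': "primeideal P' R" "Q \<subset> P'" "P' \<subseteq> Q1" for P'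
  proof (rule ccontr)
    assume "P' \<noteq> Q1"
    then have "prime_chain P (Suc n) P'" using prime_chain_Suc[OF P'(1) _ Q1(3) chain] P' by blast
    then show False using prime_chain_Suc[OF Suc.prems(1) P'(2)] P' Q1 Suc.prems(3) by blast
  qed
  obtain hs c where hs: "frob_frame Q1 hs c" using ex[OF Q1(1)] by blast
  have "p * (p ^ n * length gs) \<le> p * length hs"
    by (intro mult_le_mono2 Suc.IH[OF Q1(1) chain nochain hs])
  also have "\<dots> \<le> length fs"
    by (rule frob_rank_step[OF noeth Q1(1) Suc.prems(1) Q1(2) adj Suc.prems(4) hs])
  finally show ?case by (simp add: mult_ac)
qed

section \<open>Frames from F-finiteness\<close>

lemma finsum_in_frob_span:
  assumes "finite A"
  shows "A \<subseteq> carrier R \<Longrightarrow> \<exists>ts. set ts \<subseteq> carrier R \<and> (\<forall>Q. ideal Q R \<longrightarrow>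
    (\<forall>a\<in>A \<rightarrow> carrier R. (\<Oplus>s\<in>A. frob (a s) \<otimes> s) \<in> frob_span Q (carrier R) ts))"
  using assms
proof (induction A)
  case empty
  then show ?case using idealD(2) by (intro exI[of _ "[]"]) auto
next
  case (insert x A)
  then obtain ts where ts: "set ts \<subseteq> carrier R"
      "\<And>Q a. ideal Q R \<Longrightarrow> a \<in> A \<rightarrow> carrier R \<Longrightarrow> (\<Oplus>s\<in>A. frob (a s) \<otimes> s) \<in> frob_span Q (carrier R) ts"
    by auto
  have "(\<Oplus>s\<in>insert x A. frob (a s) \<otimes> s) \<in> frob_span Q (carrier R) (x # ts)"
    if Q: "ideal Q R" and a: "a \<in> insert x A \<rightarrow> carrier R" for Q a
  proof -
    have "(\<Oplus>s\<in>insert x A. frob (a s) \<otimes> s) = frob (a x) \<otimes> x \<oplus> (\<Oplus>s\<in>A. frob (a s) \<otimes> s)"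
      using insert a by (intro finsum_insert) (auto simp: Pi_iff)
    moreover have "(\<Oplus>s\<in>A. frob (a s) \<otimes> s) \<in> frob_span Q (carrier R) ts"
      using ts(2)[OF Q] a by auto
    ultimately show ?thesis using a by (auto intro!: set_addI)
  qed
  then show ?case using ts(1) insert.prems by (intro exI[of _ "x # ts"]) auto
qed

lemma F_finite_frob_frame:
  assumes F: "F_finite R p" and Q: "primeideal Q R"
  shows "\<exists>fs b. frob_frame Q fs b"
proof -
  obtain A where A: "finite A" "A \<subseteq> carrier R"
    and span: "\<And>x. x \<in> carrier R \<Longrightarrow> \<exists>a\<in>A \<rightarrow> carrier R. x = (\<Oplus>s\<in>A. frob (a s) \<otimes> s)"
  proof -
    \<comment> \<open>Sums in the twisted module only see the addition of R.\<close>
    have fin: "finsum (module_via R frob) f A = finsum R f A" for f A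
      by (simp add: finsum_def finprod_def module_via_def)
    show thesis
      using F that unfolding F_finite_def finitely_generated_module_def fin
      by (auto simp: module_via_def)
  qed
  obtain ts where ts: "set ts \<subseteq> carrier R"
      "\<forall>Q. ideal Q R \<longrightarrow>
    (\<forall>a\<in>A \<rightarrow> carrier R. (\<Oplus>s\<in>A. frob (a s) \<otimes> s) \<in> frob_span Q (carrier R) ts)"
    using finsum_in_frob_span[OF A] by blast
  have "x \<in> frob_span Q (carrier R) ts" if "x \<in> carrier R" for x
    using span[OF that] ts(2) primeD(1)[OF Q] by blast
  then show ?thesis using frob_frame_exists[OF Q ts(1)] by blast
qed

end

subsection \<open>Colength as relative length\<close>

context cring begin

lemma exists_maximalideal:
  assumes noeth: "noetherian_ring R" and J: "ideal J R" "J \<noteq> carrier R"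
  shows "\<exists>M. maximalideal M R \<and> J \<subseteq> M"
proof -
  have "J \<noteq> carrier R \<longrightarrow> (\<exists>M. maximalideal M R \<and> J \<subseteq> M)"
  proof (rule noetherian_ideal_induct[OF noeth J(1)], rule impI)
    fix J assume J: "ideal J R" "J \<noteq> carrier R"
      and IH: "\<And>J'. ideal J' R \<Longrightarrow> J \<subset> J' \<Longrightarrow> J' \<noteq> carrier R \<longrightarrow> (\<exists>M. maximalideal M R \<and> J' \<subseteq> M)"
    show "\<exists>M. maximalideal M R \<and> J \<subseteq> M"
    proof (cases "\<exists>J'. ideal J' R \<and> J \<subset> J' \<and> J' \<noteq> carrier R")
      case True
      then show ?thesis using IH by blast
    next
      case False
      then have "maximalideal J R"
        using J idealD(1) by (intro maximalidealI) auto
      then show ?thesis by blast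
    qed
  qed
  then show ?thesis using J by blast
qed

text \<open>Turns recursive chains into sequences, the form in which \<open>chain_height\<close>
  counts; the next lemma goes back.\<close>

lemma strict_chain_imp_chain:
  "strict_chain S Y n A B \<Longrightarrow> submod S A \<Longrightarrow> \<exists>C. C 0 = A \<and> (\<forall>i\<le>n. submod S (C i) \<and> A \<subseteq> C i \<and> C i \<subseteq> B) \<and>
     (\<forall>i<n. C i \<subseteq> C (Suc i) \<and> \<not> absorbs Y (C i) (C (Suc i)))"
proof (induction n arbitrary: A)
  case 0
  then show ?case by (intro exI[of _ "\<lambda>_. A"]) auto
next
  case (Suc n)
  then obtain D where D: "submod S D" "A \<subseteq> D" "D \<subseteq> B" "\<not> absorbs Y A D" "strict_chain S Y n D B"
    by auto
  then obtain C where C: "C 0 = D" "\<And>i. i\<le>n \<Longrightarrow> submod S (C i) \<and> D \<subseteq> C i \<and> C i \<subseteq> B"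
     "\<And>i. i<n \<Longrightarrow> C i \<subseteq> C (Suc i) \<and> \<not> absorbs Y (C i) (C (Suc i))"
    using Suc.IH[OF D(5,1)] by blast
  define E where "E = (\<lambda>i. case i of 0 \<Rightarrow> A | Suc i \<Rightarrow> C i)"
  have "submod S (E i) \<and> A \<subseteq> E i \<and> E i \<subseteq> B" if "i \<le> Suc n" for i
  proof (cases i)
    case 0
    then show ?thesis using Suc.prems D by (auto simp: E_def)
  next
    case (Suc j)
    then show ?thesis using C(2)[of j] that D(2) by (auto simp: E_def)
  qed
  moreover have "E i \<subseteq> E (Suc i) \<and> \<not> absorbs Y (E i) (E (Suc i))" if "i < Suc n" for i
    using that C(1,3) D(2,4) by (cases i) (auto simp: E_def)
  ultimately show ?case by (intro exI[of _ E]) (auto simp: E_def)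
qed

lemma chain_imp_strict_chain:
  assumes "\<And>i. i \<le> n \<Longrightarrow> submod S (C i) \<and> A \<subseteq> C i \<and> C i \<subseteq> B"
    "\<And>i. i < n \<Longrightarrow> C i \<subseteq> C (Suc i) \<and> \<not> absorbs Y (C i) (C (Suc i))"
  shows "strict_chain S Y n A B"
  using assms
proof (induction n arbitrary: A C)
  case 0
  then show ?case by auto
next
  case (Suc n)
  note step = Suc.prems(2)
  have mono: "C 1 \<subseteq> C (Suc i)" if "i \<le> n" for i
    using that
  proof (induction i)
    case (Suc i)
    then show ?case using step[of "Suc i"] by auto
  qed simp
  have "strict_chain S Y n (C 1) B"
    using Suc.prems mono by (intro Suc.IH[of "\<lambda>i. C (Suc i)"]) auto
  moreover have "\<not> absorbs Y A (C 1)"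
    using Suc.prems(1)[of 0] Suc.prems(2)[of 0] absorbs_mono[of Y A "C 1" "C 0" "C 1"] by auto
  ultimately show ?case using Suc.prems(1)[of 1] by auto
qed

text \<open>Elements outside P are units, so absorption is plain inclusion and localising changes
  nothing; chains then correspond under preimage and image along R \<rightarrow> R/J.\<close>

lemma quotient_length_eq_lenR:
  assumes P: "primeideal P R" and units: "carrier R - P \<subseteq> Units R" and J: "ideal J R"
  shows "quotient_length R J = lenR P J (carrier R)"
proof -
  interpret J: ideal J R by fact
  interpret Q: cring "R Quot J" by (rule J.quotient_is_cring[OF is_cring])
  define \<phi> where "\<phi> = (\<lambda>r. J +> r)"
  define M where "M = module_via (R Quot J) \<phi>"
  have hom: "\<phi> \<in> ring_hom R (R Quot J)" unfolding \<phi>_def by (rule J.rcos_ring_hom)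
  interpret \<phi>: ring_hom_cring R "R Quot J" \<phi>
    unfolding \<phi>_def by (rule J.rcos_ring_hom_cring[OF is_cring])
  interpret M: module R M
    unfolding M_def by (rule module_via_is_module[OF is_cring Q.is_cring hom])
  have Mops: "carrier M = carrier (R Quot J)" "\<zero>\<^bsub>M\<^esub> = \<zero>\<^bsub>R Quot J\<^esub>"
    "\<And>x y. x \<oplus>\<^bsub>M\<^esub> y = x \<oplus>\<^bsub>R Quot J\<^esub> y" "\<And>r x. r \<odot>\<^bsub>M\<^esub> x = \<phi> r \<otimes>\<^bsub>R Quot J\<^esub> x"
    "\<And>x. \<ominus>\<^bsub>M\<^esub> x = \<ominus>\<^bsub>R Quot J\<^esub> x"
    by (auto simp: M_def module_via_def a_inv_def m_inv_def)
  have surj: "\<exists>r\<in>carrier R. x = \<phi> r" if "x \<in> carrier (R Quot J)" for x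
    using that by (auto simp: FactRing_def A_RCOSETS_def' \<phi>_def)
  have \<phi>0: "\<phi> r = \<zero>\<^bsub>R Quot J\<^esub> \<longleftrightarrow> r \<in> J" if "r \<in> carrier R" for r
    using that J.a_rcos_const J.rcos_const_imp_mem by (auto simp: \<phi>_def FactRing_def)
  have absorbs: "absorbs (carrier R - P) A D \<longleftrightarrow> D \<subseteq> A" if "ideal A R" "D \<subseteq> carrier R" for A D
  proof
    assume ab: "absorbs (carrier R - P) A D"
    show "D \<subseteq> A"
    proof
      fix d assume d: "d \<in> D"
      then obtain y where y: "y \<in> carrier R - P" "y \<otimes> d \<in> A" using ab by (auto simp: absorbs_def)
      then have "inv y \<otimes> (y \<otimes> d) \<in> A" using idealD(4)[OF that(1)] units by auto
      then show "d \<in> A" using y units d that(2) by (auto simp: m_assoc[symmetric] subset_iff)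
    qed
  next
    assume "D \<subseteq> A"
    then show "absorbs (carrier R - P) A D"
      unfolding absorbs_def using primeD(2)[OF P] that(2)
      by (auto intro!: bexI[of _ \<one>] simp: subset_iff)
  qed
  have "(\<exists>C :: nat \<Rightarrow> 'a set set. (\<forall>i\<le>n. C i \<in> {N. submodule N R M}) \<and> (\<forall>i<n. C i \<subset> C (Suc i))) \<longleftrightarrow>
      strict_chain (carrier R) (carrier R - P) n J (carrier R)" (is "?L \<longleftrightarrow> ?R") for n
  proof
    assume ?L
    then obtain C :: "nat \<Rightarrow> 'a set set" where C: "\<And>i. i \<le> n \<Longrightarrow> submodule (C i) R M"
        "\<And>i. i < n \<Longrightarrow> C i \<subset> C (Suc i)" by auto
    define D where "D i = {r \<in> carrier R. \<phi> r \<in> C i}" for i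
    have D: "ideal (D i) R" "J \<subseteq> D i" if "i \<le> n" for i
    proof -
      interpret N: submodule "C i" R M using C(1)[OF that] .
      have zero: "\<zero>\<^bsub>R Quot J\<^esub> \<in> C i" using N.one_closed by (simp add: Mops)
      show "ideal (D i) R"
        unfolding submod_carrier_iff[symmetric]
      proof (rule submodI)
        show "\<zero> \<in> D i" using zero by (simp add: D_def)
        show "x \<oplus> y \<in> D i" if "x \<in> D i" "y \<in> D i" for x y
          using that N.m_closed by (simp add: D_def Mops)
        show "s \<otimes> x \<in> D i" if "s \<in> carrier R" "x \<in> D i" for s x
          using that N.smult_closed[of s "\<phi> x"] by (simp add: D_def Mops)
      qed (auto simp: D_def)
      have "\<phi> x \<in> C i" if "x \<in> J" for x
        using \<phi>0[OF J.Icarr[OF that]] that zero by simp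
      then show "J \<subseteq> D i" using J.Icarr by (auto simp: D_def)
    qed
    have "D i \<subset> D (Suc i)" if i: "i < n" for i
    proof -
      obtain x where x: "x \<in> C (Suc i)" "x \<notin> C i" using C(2)[OF i] by auto
      interpret N: submodule "C (Suc i)" R M using C(1) that by auto
      have "x \<in> carrier (R Quot J)" using x N.subset by (auto simp: Mops)
      then obtain r where "r \<in> carrier R" "x = \<phi> r" using surj by blast
      then show ?thesis using x C(2)[OF that] by (auto simp: D_def)
    qed
    then have "D i \<subseteq> D (Suc i) \<and> \<not> absorbs (carrier R - P) (D i) (D (Suc i))" if "i < n" for i
      using that absorbs[of "D i" "D (Suc i)"] D(1)[of i] by (auto simp: D_def)
    then show ?R
      using D idealD(1) by (intro chain_imp_strict_chain[of _ _ D]) (auto simp: submod_carrier_iff)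
  next
    assume ?R
    then obtain C where C: "\<And>i. i \<le> n \<Longrightarrow> ideal (C i) R \<and> J \<subseteq> C i \<and> C i \<subseteq> carrier R"
        "\<And>i. i < n \<Longrightarrow> C i \<subseteq> C (Suc i) \<and> \<not> absorbs (carrier R - P) (C i) (C (Suc i))"
      using strict_chain_imp_chain[OF _ J[folded submod_carrier_iff]]
      unfolding submod_carrier_iff by blast
    have "submodule (\<phi> ` C i) R M" if "i \<le> n" for i
    proof (rule M.submoduleI)
      note Ci = idealD[OF conjunct1[OF C(1)[OF that]]]
      show "\<phi> ` C i \<subseteq> carrier M" using Ci(5) by (auto simp: Mops)
      show "\<zero>\<^bsub>M\<^esub> \<in> \<phi> ` C i" using Ci(2) \<phi>.hom_zero by (auto simp: Mops intro!: image_eqI[of _ _ \<zero>])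
      fix x y assume "x \<in> \<phi> ` C i"
      then obtain a where a: "a \<in> C i" "x = \<phi> a" "a \<in> carrier R" using Ci(5) by auto
      show "\<ominus>\<^bsub>M\<^esub> x \<in> \<phi> ` C i"
        using a Ci(7)[OF Ci(2) a(1)] \<phi>.hom_a_inv[OF a(3)]
        by (auto simp: Mops a_minus_def intro!: image_eqI[of _ _ "\<ominus> a"])
      assume "y \<in> \<phi> ` C i"
      then obtain b where b: "b \<in> C i" "y = \<phi> b" "b \<in> carrier R" using Ci(5) by auto
      show "x \<oplus>\<^bsub>M\<^esub> y \<in> \<phi> ` C i"
        using a b Ci(3) \<phi>.hom_add by (auto simp: Mops intro!: image_eqI[of _ _ "a \<oplus> b"])
    next
      note Ci = idealD[OF conjunct1[OF C(1)[OF that]]]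
      fix r x assume r: "r \<in> carrier R" and "x \<in> \<phi> ` C i"
      then obtain a where a: "a \<in> C i" "x = \<phi> a" "a \<in> carrier R" using Ci(5) by auto
      show "r \<odot>\<^bsub>M\<^esub> x \<in> \<phi> ` C i"
        using a r Ci(4) by (auto simp: Mops intro!: image_eqI[of _ _ "r \<otimes> a"])
    qed
    moreover have "\<phi> ` C i \<subset> \<phi> ` C (Suc i)" if less: "i < n" for i
    proof -
      have i: "ideal (C i) R" "J \<subseteq> C i" "C (Suc i) \<subseteq> carrier R" using C(1)[of i] C(1)[of "Suc i"] that by auto
      obtain x where x: "x \<in> C (Suc i)" "x \<notin> C i"
        using C(2)[OF less] absorbs[OF i(1,3)] by auto
      have xc: "x \<in> carrier R" using x i by auto
      have "\<phi> x \<notin> \<phi> ` C i"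
      proof
        assume "\<phi> x \<in> \<phi> ` C i"
        then obtain a where a: "a \<in> C i" "\<phi> x = \<phi> a" by auto
        have ac: "a \<in> carrier R" using idealD(5)[OF i(1) a(1)] .
        have "\<phi> (x \<ominus> a) = \<zero>\<^bsub>R Quot J\<^esub>"
          using a ac xc by (simp add: a_minus_def Q.r_neg)
        then have "x \<ominus> a \<in> C i" using \<phi>0[of "x \<ominus> a"] ac xc i by auto
        then have "(x \<ominus> a) \<oplus> a \<in> C i" using idealD(3)[OF i(1)] a by blast
        then show False using x ac xc by (simp add: a_minus_def a_assoc l_neg)
      qed
      then show ?thesis using C(2)[OF that] x by blast
    qed
    ultimately show ?L by (intro exI[of _ "\<lambda>i. \<phi> ` C i"]) auto
  qed
  then show ?thesis
    unfolding quotient_length_def module_length_def chain_height_def lenR_def rel_length_def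
      M_def \<phi>_def by simp
qed

lemma pow_mem_ideal_pow:
  assumes "ideal J R" "x \<in> J"
  shows "x [^] (n::nat) \<in> J [^]\<^bsub>ideals_set R\<^esub> n"
proof (induction n)
  case 0
  then show ?case by (simp add: nat_pow_def ideals_set_def)
next
  case (Suc n)
  then have "x [^] n \<otimes> x \<in> ideal_prod R (J [^]\<^bsub>ideals_set R\<^esub> n) J"
    using assms(2) by (rule ideal_prod.prod)
  then show ?case by (simp add: nat_pow_def ideals_set_def)
qed

end

subsection \<open>The limit\<close>

text \<open>In the application \<open>a e\<close> is the colength of I_q divided by q^d, for q =
  p^e, and \<mu> is u/(p^d A). If \<mu> = 1, both error bounds come from monotone sequences; if
  \<mu> > 1, boundedness forces \<open>a e\<close> to be O(1/p^e), so the limit is 0.\<close>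

lemma quasi_geometric_limit:
  fixes a :: "nat \<Rightarrow> real" and p \<mu> B K :: real
  assumes p: "p \<ge> 2" and \<mu>: "\<mu> \<ge> 1" and K: "K \<ge> 0"
    and a0: "\<And>e. a e \<ge> 0" and aB: "\<And>e. a e \<le> B"
    and low: "\<And>e. a (Suc e) \<ge> \<mu> * a e - K / p ^ e"
  shows "\<exists>\<eta>. a \<longlonglongrightarrow> \<eta> \<and> (\<exists>C>0. \<forall>e. a e - \<eta> \<le> C / p ^ e) \<and>
    (\<forall>K'. (\<forall>e. a (Suc e) \<le> \<mu> * a e + K' / p ^ e) \<longrightarrow> (\<exists>C. \<forall>e. \<bar>a e - \<eta>\<bar> \<le> C / p ^ e))"
proof -
  have pe: "p ^ e > 0" for e using p by simp
  have half: "D / p ^ Suc e \<le> (D / 2) / p ^ e" if "D \<ge> 0" for D e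
    using that p pe[of e] by (simp add: field_simps mult_left_mono)
  have lim0: "(\<lambda>e. D / p ^ e) \<longlonglongrightarrow> 0" for D
    using p by (intro LIMSEQ_divide_realpow_zero) auto
  have low1: "a (Suc e) \<ge> a e - K / p ^ e" for e
  proof -
    have "1 * a e \<le> \<mu> * a e" using \<mu> a0 by (rule mult_right_mono)
    then show ?thesis using low[of e] by linarith
  qed
  \<comment> \<open>\<open>C \<ge> K / (1 - 1/p)\<close> makes \<open>a\<^sub>e - C/p\<^sup>e\<close> monotone.\<close>
  define C where "C = 2 * K + 1"
  define b where "b e = a e - C / p ^ e" for e
  have "incseq b"
  proof (rule incseq_SucI)
    fix e
    have "C / p ^ Suc e \<le> (C / 2) / p ^ e" using half K by (simp add: C_def)
    moreover have "K / p ^ e \<le> (C / 2) / p ^ e"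
      using pe[of e] by (intro divide_right_mono) (auto simp: C_def)
    moreover have "(C / 2) / p ^ e + (C / 2) / p ^ e = C / p ^ e" by (simp add: field_simps)
    ultimately show "b e \<le> b (Suc e)" using low1[of e] by (simp add: b_def)
  qed
  moreover have "b e \<le> B" for e
    using aB[of e] pe[of e] K by (simp add: b_def C_def) (smt (verit) divide_nonneg_pos)
  ultimately obtain \<eta> where \<eta>: "b \<longlonglongrightarrow> \<eta>" "\<And>e. b e \<le> \<eta>"
    using incseq_convergent by blast
  have "(\<lambda>e. b e + C / p ^ e) \<longlonglongrightarrow> \<eta> + 0" by (intro tendsto_add \<eta> lim0)
  then have lim: "a \<longlonglongrightarrow> \<eta>" by (simp add: b_def)
  have upper: "a e - \<eta> \<le> C / p ^ e" for e using \<eta>(2)[of e] by (simp add: b_def)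
  have "\<exists>D. \<forall>e. \<bar>a e - \<eta>\<bar> \<le> D / p ^ e" if K': "\<forall>e. a (Suc e) \<le> \<mu> * a e + K' / p ^ e" for K'
  proof (cases "\<mu> = 1")
    case True
    \<comment> \<open>Mirror image of \<open>C\<close>: with this D the sequence \<open>s\<close>
      decreases to \<eta>, which bounds \<open>a\<close> from below.\<close>
    define D where "D = 2 * \<bar>K'\<bar>"
    define s where "s e = a e + D / p ^ e" for e
    have "decseq s"
    proof (rule decseq_SucI)
      fix e
      have "D / p ^ Suc e \<le> (D / 2) / p ^ e" by (rule half) (simp add: D_def)
      moreover have "K' / p ^ e \<le> (D / 2) / p ^ e"
        using pe[of e] by (intro divide_right_mono) (auto simp: D_def)
      moreover have "(D / 2) / p ^ e + (D / 2) / p ^ e = D / p ^ e" by (simp add: field_simps)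
      moreover have "a (Suc e) \<le> a e + K' / p ^ e" using K' True by simp
      ultimately show "s (Suc e) \<le> s e" by (simp add: s_def)
    qed
    moreover have "(\<lambda>e. a e + D / p ^ e) \<longlonglongrightarrow> \<eta> + 0" by (intro tendsto_add lim lim0)
    then have "s \<longlonglongrightarrow> \<eta>" by (simp add: s_def[abs_def])
    ultimately have "\<eta> \<le> s e" for e by (rule decseq_ge)
    then have l: "\<eta> - a e \<le> D / p ^ e" for e by (simp add: s_def algebra_simps)
    have "\<bar>a e - \<eta>\<bar> \<le> (C + D) / p ^ e" for e
    proof -
      have "C / p ^ e \<ge> 0" "D / p ^ e \<ge> 0" using pe[of e] K by (auto simp: C_def D_def)
      then show ?thesis using l[of e] upper[of e] by (simp add: add_divide_distrib abs_le_iff)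
    qed
    then show ?thesis by blast
  next
    case False
    then have \<mu>1: "\<mu> > 1" using \<mu> by simp
    \<comment> \<open>\<open>a\<^sub>e - D/p\<^sup>e\<close> at least grows by the factor \<open>\<mu>\<close>, so it is not positive as \<open>a\<close> is bounded.\<close>
    define D where "D = K / (\<mu> - 1)"
    have D: "D \<ge> 0" "K + D = \<mu> * D" using K \<mu>1 by (auto simp: D_def field_simps)
    define w where "w e = a e - D / p ^ e" for e
    have wSuc: "\<mu> * w e \<le> w (Suc e)" for e
    proof -
      have "D / p ^ Suc e \<le> D / p ^ e"
        using half[OF D(1), of e] D(1) pe[of e] by (smt (verit) divide_right_mono field_sum_of_halves)
      moreover have "K / p ^ e + D / p ^ e = \<mu> * (D / p ^ e)"
        using D(2) by (simp add: add_divide_distrib[symmetric])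
      ultimately show ?thesis using low[of e] by (simp add: w_def right_diff_distrib)
    qed
    have wpow: "\<mu> ^ n * w e \<le> w (e + n)" for n e
    proof (induction n)
      case (Suc n)
      have "\<mu> ^ Suc n * w e = \<mu> * (\<mu> ^ n * w e)" by simp
      also have "\<dots> \<le> \<mu> * w (e + n)" using Suc \<mu> by (intro mult_left_mono) auto
      also have "\<dots> \<le> w (e + Suc n)" using wSuc by simp
      finally show ?case .
    qed simp
    have w0: "w e \<le> 0" for e
    proof (rule ccontr)
      assume "\<not> w e \<le> 0"
      then have we: "w e > 0" by simp
      obtain n where "B / w e < \<mu> ^ n" using real_arch_pow[OF \<mu>1] by blast
      then have "B < \<mu> ^ n * w e" using we by (simp add: field_simps)
      also have "\<dots> \<le> w (e + n)" by (rule wpow)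
      also have "\<dots> \<le> a (e + n)" using D(1) pe[of "e + n"] by (simp add: w_def)
      finally show False using aB[of "e + n"] by simp
    qed
    then have aD: "a e \<le> D / p ^ e" for e using w0[of e] by (simp add: w_def)
    have "a \<longlonglongrightarrow> 0"
      by (rule tendsto_sandwich[OF _ _ tendsto_const lim0[of D]]) (use a0 aD in auto)
    then have "\<eta> = 0" using lim LIMSEQ_unique by blast
    then show ?thesis using aD a0 by (intro exI[of _ D]) auto
  qed
  then show ?thesis using lim upper K by (intro exI[of _ \<eta>] conjI exI[of _ C]) (auto simp: C_def)
qed

section \<open>Dimension, uniform bounds and the final estimate\<close>

lemma chain_height_eq_enatD:
  assumes "chain_height F = enat d" "F \<noteq> {}"
  shows "\<exists>C :: nat \<Rightarrow> 'a set. (\<forall>i\<le>d. C i \<in> F) \<and> (\<forall>i<d. C i \<subset> C (Suc i))"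
    "\<not> (\<exists>C :: nat \<Rightarrow> 'a set. (\<forall>i\<le>Suc d. C i \<in> F) \<and> (\<forall>i<Suc d. C i \<subset> C (Suc i)))"
proof -
  define T where "T n \<longleftrightarrow> (\<exists>C :: nat \<Rightarrow> 'a set. (\<forall>i\<le>n. C i \<in> F) \<and> (\<forall>i<n. C i \<subset> C (Suc i)))" for n
  have h: "Sup {enat n | n. T n} = enat d" using assms(1) by (simp add: chain_height_def T_def)
  then have le: "n \<le> d" if "T n" for n
    using that Sup_upper[of "enat n" "{enat n | n. T n}"] by auto
  have "T d"
  proof (rule ccontr)
    assume not: "\<not> T d"
    \<comment> \<open>Nonemptiness supplies a chain of length 0; this matters for d = 0, because the
      empty supremum is 0 too.\<close>
    obtain N where "N \<in> F" using assms(2) by blast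
    then have "T 0" unfolding T_def by (auto intro!: exI[of _ "\<lambda>_. N"])
    then have "d > 0" using not by (cases d) auto
    have "n \<le> d - 1" if "T n" for n using le[OF that] not that by (cases "n = d") auto
    then have "Sup {enat n | n. T n} \<le> enat (d - 1)" by (auto intro!: Sup_least)
    then show False using h \<open>d > 0\<close> by simp
  qed
  then show "\<exists>C :: nat \<Rightarrow> 'a set. (\<forall>i\<le>d. C i \<in> F) \<and> (\<forall>i<d. C i \<subset> C (Suc i))" by (simp add: T_def)
  show "\<not> (\<exists>C :: nat \<Rightarrow> 'a set. (\<forall>i\<le>Suc d. C i \<in> F) \<and> (\<forall>i<Suc d. C i \<subset> C (Suc i)))"
    unfolding T_def[symmetric] using le[of "Suc d"] by auto
qed

lemma (in cring) local_units:
  assumes noeth: "noetherian_ring R" and loc: "local_with_maximal R \<mm>"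
  shows "carrier R - \<mm> \<subseteq> Units R"
proof
  fix y assume y: "y \<in> carrier R - \<mm>"
  have "PIdl y = carrier R"
  proof (rule ccontr)
    assume "PIdl y \<noteq> carrier R"
    then obtain M where "maximalideal M R" "PIdl y \<subseteq> M"
      using exists_maximalideal[OF noeth] cgenideal_ideal y by blast
    then show False using loc y cgenideal_self[of y] by (auto simp: local_with_maximal_def)
  qed
  then obtain r where "r \<in> carrier R" "\<one> = y \<otimes> r"
    using mem_cgenideal_iff[of y \<one>] y by auto
  then show "y \<in> Units R" using y by (auto simp: Units_def m_comm intro!: bexI[of _ r])
qed

lemma (in prime_char_ring) normalized_length_limit:
  assumes dom: "noetherian_domain R" and loc: "local_with_maximal R \<mm>" and F: "F_finite R p"
    and dim: "krull_dim R = enat d" and inv: "weakly_inverse_p_family R p I" and bbl: "BBL R \<mm> p I"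
  shows "\<exists>\<eta>::real.
      (\<lambda>e. normalized_length R d I (p ^ e)) \<longlonglongrightarrow> ereal \<eta> \<and>
      (\<exists>C::real. C > 0 \<and>
         (\<forall>e. normalized_length R d I (p ^ e) - ereal \<eta> \<le> ereal (C / real (p ^ e)))) \<and>
      (weakly_p_family R p I \<longrightarrow>
         (\<exists>C::real. \<forall>e. \<bar>normalized_length R d I (p ^ e) - ereal \<eta>\<bar> \<le> ereal (C / real (p ^ e))))"
proof -
  interpret noetherian_domain R by (rule dom)
  note noeth = noetherian_ring_axioms
  have p2: "p \<ge> 2" using prime_p prime_ge_2_nat by blast
  have max: "maximalideal \<mm> R" "\<And>M. maximalideal M R \<Longrightarrow> M = \<mm>"
    using loc by (auto simp: local_with_maximal_def)
  have P: "primeideal \<mm> R" using maximalideal_prime[OF max(1)] .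
  have prime_sub: "Q \<subseteq> \<mm>" if "primeideal Q R" for Q
    using exists_maximalideal[OF noeth primeD(1)[OF that]] max(2) primeD(2)[OF that] by auto
  have units: "carrier R - \<mm> \<subseteq> Units R" by (rule local_units[OF noeth loc])
  have Z: "primeideal {\<zero>} R" "ideal {\<zero>} R" using zeroprimeideal zeroideal by auto
  have Iid: "ideal (I (p ^ e)) R" for e
    using inv by (auto simp: weakly_inverse_p_family_def ideal_family_def)
  obtain c' where c': "\<And>e. \<mm> [^]\<^bsub>ideals_set R\<^esub> (c' * p ^ e) \<subseteq> I (p ^ e)"
    using bbl by (auto simp: BBL_def)
  \<comment> \<open>The shift by one keeps the exponent c q positive even if the given constant is
    0, as \<open>power_length_bound\<close> requires.\<close>
  define c where "c = Suc c'"
  have pw: "\<forall>x\<in>\<mm>. x [^] (c * p ^ e) \<in> I (p ^ e)" for e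
  proof
    fix x assume x: "x \<in> \<mm>"
    have xc: "x \<in> carrier R" using idealD(5)[OF primeD(1)[OF P] x] .
    have "x [^] (c' * p ^ e) \<in> I (p ^ e)" using pow_mem_ideal_pow[OF primeD(1)[OF P] x] c' by blast
    then have "x [^] (c' * p ^ e) \<otimes> x [^] (p ^ e) \<in> I (p ^ e)" using idealD(6)[OF Iid] xc by blast
    then show "x [^] (c * p ^ e) \<in> I (p ^ e)" using xc by (simp add: c_def nat_pow_mult add.commute)
  qed
  \<comment> \<open>If R/J has dimension below k, the colength of I_q + J is O(q^(k-1)): this is
    \<open>power_length_bound\<close> for n = c q, with c^k moved into the constant.\<close>
  have bound: "\<exists>B::nat. \<forall>e. \<exists>l. lenR \<mm> (I (p ^ e) <+> J) (carrier R) = enat l \<and>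
      p ^ e * l \<le> B * (p ^ e) ^ k" if J: "ideal J R" "\<not> prime_chain \<mm> k J" for J k
  proof -
    obtain B where B: "\<And>n W. n \<ge> 1 \<Longrightarrow> ideal W R \<Longrightarrow> (\<forall>x\<in>\<mm>. x [^] n \<in> W) \<Longrightarrow>
        of_nat n * lenR \<mm> (J <+> W) (carrier R) \<le> of_nat (B * n ^ k)"
      using power_length_bound[OF noeth P J] by blast
    have "\<exists>l. lenR \<mm> (I (p ^ e) <+> J) (carrier R) = enat l \<and> p ^ e * l \<le> (B * c ^ k) * (p ^ e) ^ k" for e
    proof -
      have "c * p ^ e > 0" using p2 by (simp add: c_def)
      then have n1: "c * p ^ e \<ge> 1" by linarith
      have comm: "J <+> I (p ^ e) = I (p ^ e) <+> J"
        using set_add_commute idealD(1) J Iid by blast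
      have *: "enat (c * p ^ e) * lenR \<mm> (I (p ^ e) <+> J) (carrier R) \<le> enat (B * (c * p ^ e) ^ k)"
        using B[OF n1 Iid pw] unfolding comm by (simp only: of_nat_eq_enat)
      then obtain l where l: "lenR \<mm> (I (p ^ e) <+> J) (carrier R) = enat l"
        using n1 p2 by (cases "lenR \<mm> (I (p ^ e) <+> J) (carrier R)") (auto simp: imult_is_infinity split: if_splits)
      have "p ^ e * l \<le> c * p ^ e * l" by (simp add: c_def)
      also have "\<dots> \<le> B * (c * p ^ e) ^ k" using * unfolding l by simp
      also have "\<dots> = (B * c ^ k) * (p ^ e) ^ k" by (simp add: power_mult_distrib)
      finally show ?thesis using l by blast
    qed
    then show ?thesis by blast
  qed
  have prs: "{Q. primeideal Q R} \<noteq> {}" using P by blast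
  note kd = chain_height_eq_enatD[OF dim[unfolded krull_dim_def] prs]
  have "{\<zero>} \<subseteq> Q \<and> Q \<subseteq> \<mm>" if "primeideal Q R" for Q
    using prime_sub[OF that] idealD(2)[OF primeD(1)[OF that]] by blast
  then have "prime_chain \<mm> n {\<zero>} \<longleftrightarrow>
      (\<exists>C :: nat \<Rightarrow> 'a set. (\<forall>i\<le>n. C i \<in> {Q. primeideal Q R}) \<and> (\<forall>i<n. C i \<subset> C (Suc i)))" for n
    unfolding prime_chain_def mem_Collect_eq by meson
  with kd have chain: "prime_chain \<mm> d {\<zero>}" and nochain: "\<not> prime_chain \<mm> (Suc d) {\<zero>}"
    by simp_all
  \<comment> \<open>Modulo a nonzero y the dimension drops: a chain of length d above y would extend
    downwards by the zero ideal, which is prime.\<close>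
  have nochain': "\<not> prime_chain \<mm> d (PIdl y)" if y: "y \<in> carrier R" "y \<noteq> \<zero>" for y
  proof
    assume *: "prime_chain \<mm> d (PIdl y)"
    have "{\<zero>} \<subset> PIdl y" using cgenideal_self[OF y(1)] idealD(2)[OF cgenideal_ideal[OF y(1)]] y(2) by auto
    moreover have "PIdl y \<subseteq> \<mm>" using * unfolding prime_chain_def by (meson le0 order_trans)
    ultimately show False using prime_chain_Suc[OF Z(1) _ _ *] nochain by blast
  qed
  obtain fs b where fs: "frob_frame {\<zero>} fs b" using F_finite_frob_frame[OF F Z(1)] by blast
  obtain gs b' where gs: "frob_frame \<mm> gs b'" using F_finite_frob_frame[OF F P] by blast
  note r = lenS_frame[OF P gs]
  have rank: "p ^ d * length gs \<le> length fs"
    by (rule frob_rank_chain[OF noeth P gs F_finite_frob_frame[OF F] Z(1) chain nochain fs])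
  \<comment> \<open>An empty frame at the maximal ideal would put b'^p into \<mm>. Positivity allows
    the division by A below.\<close>
  have gs0: "length gs \<ge> 1"
  proof (rule ccontr)
    assume "\<not> length gs \<ge> 1"
    then have "gs = []" by (cases gs) auto
    then have "frob b' \<in> \<mm>" using frob_frameD(5)[OF gs, of \<one>] frob_frameD(3)[OF gs] by simp
    then show False using prime_pow_notin[OF P] frob_frameD(3,4)[OF gs] by blast
  qed
  have b: "b \<in> carrier R" "b \<noteq> \<zero>" using frob_frameD(3,4)[OF fs] by auto
  have add0: "J <+> {\<zero>} = J" if "ideal J R" for J
    using idealD(5)[OF that] by (auto simp: mem_set_add_iff)
  define q where "q e = p ^ e" for e
  have q0: "q e > 0" for e using p2 by (simp add: q_def)
  \<comment> \<open>The case J = 0 and k = d + 1: colengths are O(q^d), so the normalised lengths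
    are bounded.\<close>
  obtain B where B: "\<And>e. \<exists>l. lenR \<mm> (I (q e)) (carrier R) = enat l \<and> q e * l \<le> B * q e ^ Suc d"
    using bound[OF Z(2) nochain] unfolding add0[OF Iid] q_def by blast
  define L where "L e = the_enat (lenR \<mm> (I (q e)) (carrier R))" for e
  have L: "lenR \<mm> (I (q e)) (carrier R) = enat (L e)" "L e \<le> B * q e ^ d" for e
  proof -
    obtain l where l: "lenR \<mm> (I (q e)) (carrier R) = enat l" "q e * l \<le> B * q e ^ Suc d" using B by blast
    then show "lenR \<mm> (I (q e)) (carrier R) = enat (L e)" by (simp add: L_def)
    have "q e * l \<le> q e * (B * q e ^ d)" using l(2) by (simp add: mult_ac)
    then show "L e \<le> B * q e ^ d" using q0[of e] l(1) by (simp add: L_def)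
  qed
  define u where "u = length fs"
  define A where "A = length gs"
  obtain s where s: "s \<in> carrier R" "s \<noteq> \<zero>"
      and sI: "\<And>e. s <# I (p * p ^ e) \<subseteq> frobenius_power R p (I (p ^ e))"
    using inv by (auto simp: weakly_inverse_p_family_def)
  have sb: "s \<otimes> b \<in> carrier R" "s \<otimes> b \<noteq> \<zero>" using s b integral by auto
  \<comment> \<open>Since sb is nonzero, the error ideals I_q + (sb) have colength
    O(q^(d-1)).\<close>
  obtain K where K: "\<And>e. \<exists>l. lenR \<mm> (I (q e) <+> PIdl (s \<otimes> b)) (carrier R) = enat l \<and> q e * l \<le> K * q e ^ d"
    using bound[OF cgenideal_ideal[OF sb(1)] nochain'[OF sb]] unfolding q_def by blast
  have low: "q e * (u * L e) \<le> q e * (A * L (Suc e)) + u * (K * q e ^ d)" for e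
  proof -
    obtain l where l: "lenR \<mm> (I (q e) <+> PIdl (s \<otimes> b)) (carrier R) = enat l" "q e * l \<le> K * q e ^ d"
      using K by blast
    have "of_nat u * lenR \<mm> (I (q e)) (carrier R) \<le> of_nat A * of_nat (L (Suc e)) +
        of_nat u * lenR \<mm> (I (q e) <+> PIdl (s \<otimes> b)) (carrier R)"
      unfolding u_def A_def
    proof (rule length_lower_frob[OF P Z(2) fs r _ _ _ s(1)])
      show "ideal (I (q e)) R" "ideal (I (q (Suc e))) R" using Iid by (auto simp: q_def simp del: power_Suc)
      show "{\<zero>} \<subseteq> I (q e)" using idealD(2)[OF Iid] by (simp add: q_def)
      show "s \<otimes> z \<in> frobenius_power R p (I (q e))" if "z \<in> I (q (Suc e))" for z
        using sI[of e] that by (auto simp: l_coset_def q_def)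
      show "lenR \<mm> (I (q (Suc e))) (carrier R) = of_nat (L (Suc e))" using L by (simp add: of_nat_eq_enat)
    qed
    then have "u * L e \<le> A * L (Suc e) + u * l" unfolding L l by (simp add: of_nat_eq_enat)
    then have "q e * (u * L e) \<le> q e * (A * L (Suc e) + u * l)" by (rule mult_le_mono2)
    also have "\<dots> = q e * (A * L (Suc e)) + u * (q e * l)" by (simp add: algebra_simps)
    also have "\<dots> \<le> q e * (A * L (Suc e)) + u * (K * q e ^ d)"
      by (intro add_left_mono mult_le_mono2 l)
    finally show ?thesis .
  qed
  have upp: "\<exists>K'::nat. \<forall>e. q e * (A * L (Suc e)) \<le> q e * (u * L e) + A * (K' * q e ^ d)"
    if fam: "weakly_p_family R p I"
  proof -
    obtain t where t: "t \<in> carrier R" "t \<noteq> \<zero>"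
        and tI: "\<And>e. t <# frobenius_power R p (I (p ^ e)) \<subseteq> I (p * p ^ e)"
      using fam by (auto simp: weakly_p_family_def)
    have "frob b \<noteq> \<zero>" using prime_pow_notin[OF Z(1)] b by auto
    then have tb: "t \<otimes> frob b \<in> carrier R" "t \<otimes> frob b \<noteq> \<zero>" using t b integral by auto
    obtain M where M: "\<And>e. \<exists>l. lenR \<mm> (I (q e) <+> PIdl (t \<otimes> frob b)) (carrier R) = enat l \<and> q e * l \<le> M * q e ^ d"
      using bound[OF cgenideal_ideal[OF tb(1)] nochain'[OF tb]] unfolding q_def by blast
    \<comment> \<open>The error term sits at the index pq, hence the extra factor p^d in its
      bound.\<close>
    have "q e * (A * L (Suc e)) \<le> q e * (u * L e) + A * ((M * p ^ d) * q e ^ d)" for e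
    proof -
      obtain l where l: "lenR \<mm> (I (q (Suc e)) <+> PIdl (t \<otimes> frob b)) (carrier R) = enat l"
          "q (Suc e) * l \<le> M * q (Suc e) ^ d"
        using M by blast
      have "of_nat A * of_nat (L (Suc e)) \<le> of_nat u * lenR \<mm> (I (q e)) (carrier R) +
          of_nat A * lenR \<mm> (I (q (Suc e)) <+> PIdl (t \<otimes> frob b)) (carrier R)"
        unfolding u_def A_def
      proof (rule length_upper_frob[OF P Z(2) fs r _ _ _ _ t(1)])
        show "ideal (I (q e)) R" "ideal (I (q (Suc e))) R" using Iid by (auto simp: q_def simp del: power_Suc)
        show "{\<zero>} \<subseteq> I (q e)" "{\<zero>} \<subseteq> I (q (Suc e))"
          using idealD(2)[OF Iid] by (auto simp: q_def simp del: power_Suc)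
        show "t \<otimes> frob z \<in> I (q (Suc e))" if "z \<in> I (q e)" for z
        proof -
          have "frob ` I (q e) \<subseteq> carrier R" using idealD(5)[OF Iid] by (auto simp: q_def)
          then have "frob z \<in> frobenius_power R p (I (q e))"
            using that genideal_self unfolding frobenius_power_def by blast
          then show ?thesis using tI[of e] by (auto simp: l_coset_def q_def)
        qed
        show "lenR \<mm> (I (q (Suc e))) (carrier R) = of_nat (L (Suc e))" using L by (simp add: of_nat_eq_enat)
      qed
      then have "A * L (Suc e) \<le> u * L e + A * l" unfolding L l by (simp add: of_nat_eq_enat)
      then have "q e * (A * L (Suc e)) \<le> q e * (u * L e + A * l)" by (rule mult_le_mono2)
      also have "\<dots> = q e * (u * L e) + A * (q e * l)" by (simp add: algebra_simps)
      also have "q e * l \<le> q (Suc e) * l" using p2 by (simp add: q_def)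
      also have "\<dots> \<le> (M * p ^ d) * q e ^ d" using l(2) by (simp add: q_def power_mult_distrib mult_ac)
      finally show ?thesis by (simp add: add_left_mono mult_le_mono2)
    qed
    then show ?thesis by blast
  qed
  define a where "a e = real (L e) / real (q e) ^ d" for e
  \<comment> \<open>The factor by which the main term of the comparison multiplies
    \<open>a e\<close>; \<open>rank\<close> says that it is at least 1.\<close>
  define \<mu> where "\<mu> = real u / (real A * real p ^ d)"
  have A0: "A > 0" using gs0 unfolding A_def by linarith
  have den: "real A * real p ^ d > 0" using A0 p2 by simp
  have qd: "real (q e) ^ d > 0" for e using q0[of e] by simp
  have aSuc: "a (Suc e) = real (A * L (Suc e)) / (real A * real p ^ d * real (q e) ^ d)" for e
    using A0 by (simp add: a_def q_def power_mult_distrib)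
  have \<mu>a: "\<mu> * a e = real (u * L e) / (real A * real p ^ d * real (q e) ^ d)" for e
    by (simp add: a_def \<mu>_def)
  \<comment> \<open>Division by A p^d q^(d+1) turns the error k q^d into a constant over q.\<close>
  have scale: "x / (real A * real p ^ d * real (q e) ^ d) \<le>
      y / (real A * real p ^ d * real (q e) ^ d) + (k / (real A * real p ^ d)) / real (q e)"
    if "real (q e) * x \<le> real (q e) * y + k * real (q e) ^ d" for x y k e
  proof -
    define W where "W = real A * real p ^ d * real (q e) ^ d"
    have W: "W > 0" unfolding W_def using den qd[of e] by simp
    have "x \<le> y + k * real (q e) ^ d / real (q e)"
      using that q0[of e] by (simp add: field_simps)
    then have "x / W \<le> (y + k * real (q e) ^ d / real (q e)) / W"
      using W by (intro divide_right_mono) auto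
    also have "\<dots> = y / W + (k / (real A * real p ^ d)) / real (q e)"
      using q0[of e] qd[of e] by (simp add: W_def add_divide_distrib)
    finally show ?thesis by (simp add: W_def)
  qed
  have "\<mu> \<ge> 1"
  proof -
    have "real (p ^ d * length gs) \<le> real (length fs)" using rank by (simp only: of_nat_le_iff)
    then show ?thesis using den by (simp add: \<mu>_def u_def A_def mult.commute)
  qed
  moreover have "a (Suc e) \<ge> \<mu> * a e - (real (u * K) / (real A * real p ^ d)) / real p ^ e" for e
  proof -
    have "real (q e * (u * L e)) \<le> real (q e * (A * L (Suc e)) + u * (K * q e ^ d))"
      using low[of e] by (simp only: of_nat_le_iff)
    then have "real (q e) * real (u * L e) \<le> real (q e) * real (A * L (Suc e)) + real (u * K) * real (q e) ^ d"
      by (simp add: mult.assoc)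
    from scale[OF this] show ?thesis
      unfolding aSuc \<mu>a by (simp add: q_def)
  qed
  moreover have "a e \<ge> 0" for e by (simp add: a_def)
  moreover have "a e \<le> real B" for e
  proof -
    have "real (L e) \<le> real (B * q e ^ d)" using L(2)[of e] by (simp only: of_nat_le_iff)
    then show ?thesis using qd[of e] by (simp add: a_def field_simps)
  qed
  moreover have "real (u * K) / (real A * real p ^ d) \<ge> 0" using den by simp
  moreover have "real p \<ge> 2" using p2 by simp
  ultimately obtain \<eta> where \<eta>: "a \<longlonglongrightarrow> \<eta>" "\<exists>C>0. \<forall>e. a e - \<eta> \<le> C / real p ^ e"
    "\<And>K'. \<forall>e. a (Suc e) \<le> \<mu> * a e + K' / real p ^ e \<Longrightarrow> \<exists>C. \<forall>e. \<bar>a e - \<eta>\<bar> \<le> C / real p ^ e"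
    using quasi_geometric_limit[of "real p" \<mu> "real (u * K) / (real A * real p ^ d)" a "real B"] by blast
  have "\<exists>C. \<forall>e. \<bar>a e - \<eta>\<bar> \<le> C / real p ^ e" if fam: "weakly_p_family R p I"
  proof -
    obtain K' :: nat where K': "\<And>e. q e * (A * L (Suc e)) \<le> q e * (u * L e) + A * (K' * q e ^ d)"
      using upp[OF fam] by blast
    have "a (Suc e) \<le> \<mu> * a e + (real (A * K') / (real A * real p ^ d)) / real p ^ e" for e
    proof -
      have "real (q e * (A * L (Suc e))) \<le> real (q e * (u * L e) + A * (K' * q e ^ d))"
        using K'[of e] by (simp only: of_nat_le_iff)
      then have "real (q e) * real (A * L (Suc e)) \<le> real (q e) * real (u * L e) + real (A * K') * real (q e) ^ d"
        by (simp add: mult.assoc)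
      from scale[OF this] show ?thesis
        unfolding aSuc \<mu>a by (simp add: q_def)
    qed
    then show ?thesis using \<eta>(3) by blast
  qed
  \<comment> \<open>At the maximal ideal the localised colengths are the actual lengths, and these
    are finite, so the extended-real quotient is the real number \<open>a e\<close>.\<close>
  moreover have nl: "normalized_length R d I (p ^ e) = ereal (a e)" for e
    using quotient_length_eq_lenR[OF P units Iid[of e]] L(1)[of e] qd[of e] p2
    by (simp add: normalized_length_def a_def q_def)
  ultimately show ?thesis
    unfolding nl using \<eta>(1,2) by (intro exI[of _ \<eta>]) simp
qed

theorem theorem8p12:
  fixes R :: "('a, 'b) ring_scheme" and \<mm> :: "'a set" and p d :: nat
    and I :: "nat \<Rightarrow> 'a set"
  assumes "noetherian_domain R"
    and "local_with_maximal R \<mm>"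
    and "Factorial_Ring.prime p" and "has_characteristic R p"
    and "F_finite R p"
    and "krull_dim R = enat d"
    and "weakly_inverse_p_family R p I"
    and "BBL R \<mm> p I"
  shows "\<exists>\<eta>::real.
      (\<lambda>e. normalized_length R d I (p ^ e)) \<longlonglongrightarrow> ereal \<eta> \<and>
      (\<exists>C::real. C > 0 \<and>
         (\<forall>e. normalized_length R d I (p ^ e) - ereal \<eta> \<le> ereal (C / real (p ^ e)))) \<and>
      (weakly_p_family R p I \<longrightarrow>
         (\<exists>C::real. \<forall>e. \<bar>normalized_length R d I (p ^ e) - ereal \<eta>\<bar> \<le> ereal (C / real (p ^ e))))"
proof -
  interpret noetherian_domain R by fact
  interpret prime_char_ring R p by unfold_locales (use assms in auto)
  show ?thesis using normalized_length_limit assms by blast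
qed

end
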